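(* For every $\beta$ with $0<\beta<1/4$ there exists $d_0=d_0(\beta)$ such that for every integer $d\ge d_0$ and every $d$-regular graph $G$ on $n$ vertices, \[ s(G) < \frac{n}{d}\left(1+\frac{14}{d^{\beta}}\right)+28. \]
   Context: All graphs are finite and simple. For a graph $G$ and a positive integer $k$, an edge-weighting $f:E(G)\to\{1,\dots,k\}$ is $k$-irregular if the weighted degrees $f^V(v)=\sum_{u:\{u,v\}\in E(G)} f(\{u,v\})$ are pairwise distinct over $v\in V(G)$. The irregularity strength $s(G)$ is the least $k$ for which a $k$-irregular edge-weighting exists ($s(G)=\infty$ if none exists). *)

theory Defs
  imports "HOL-Library.Extended_Real"
begin

definition simple_graph :: "'a set \<Rightarrow> 'a set set \<Rightarrow> bool" where
  "simple_graph V E \<longleftrightarrow> finite V \<and> (\<forall>e\<in>E. e \<subseteq> V \<and> card e = 2)"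

definition neighbours :: "'a set set \<Rightarrow> 'a \<Rightarrow> 'a set" where
  "neighbours E v = {u. {u, v} \<in> E}"

definition regular_graph :: "nat \<Rightarrow> 'a set \<Rightarrow> 'a set set \<Rightarrow> bool" where
  "regular_graph d V E \<longleftrightarrow> simple_graph V E \<and> (\<forall>v\<in>V. card (neighbours E v) = d)"

definition weighted_degree :: "'a set set \<Rightarrow> ('a set \<Rightarrow> nat) \<Rightarrow> 'a \<Rightarrow> nat" where
  "weighted_degree E f v = (\<Sum>u\<in>neighbours E v. f {u, v})"

definition irregular_weighting :: "nat \<Rightarrow> 'a set \<Rightarrow> 'a set set \<Rightarrow> ('a set \<Rightarrow> nat) \<Rightarrow> bool" where
  "irregular_weighting k V E f \<longleftrightarrow>
     (\<forall>e\<in>E. f e \<in> {1..k}) \<and> inj_on (weighted_degree E f) V"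

(* On enat, Inf is the least element of a nonempty set, and Inf {} is infinity. *)
definition irregularity_strength :: "'a set \<Rightarrow> 'a set set \<Rightarrow> enat" where
  "irregularity_strength V E = Inf {enat k |k. k \<ge> 1 \<and> (\<exists>f. irregular_weighting k V E f)}"

end

theory Submission
  imports Defs "HOL-Library.FuncSet" "HOL-Real_Asymp.Real_Asymp"
begin

text \<open>
  Let \<open>x = n / d\<close>. Colour the vertices with colours \<open>0, ..., K - 1\<close> so that, in every neighbourhood,
  each initial segment of colours occurs as often as in a random colouring, up to \<open>l = d powr (1/2 + e)\<close>.
  As \<open>G\<close> is regular, the colours are then equidistributed in \<open>V\<close> as well. Let \<open>S\<close> be the set of vertices
  whose colours form a top fraction of order \<open>d powr - (\<beta> + e)\<close> and \<open>B\<close> its complement. An edge inside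
  \<open>B\<close> is heavy (of weight about \<open>x\<close>) iff the colours of its ends have a large sum, so the weighted
  degrees in \<open>B\<close> nearly follow the order of the colours, at density one. Small changes on the edges
  between \<open>B\<close> and \<open>S\<close> turn them into prescribed distinct values; here \<open>\<beta> < 1/4\<close> enters.
  The edges between \<open>B\<close> and \<open>S\<close> are so heavy that \<open>S\<close> lies above \<open>B\<close>, and they cut \<open>S\<close> into nine classes
  with disjoint ranges of weighted degrees. Inside a class the edges within \<open>S\<close> first spread
  the weighted degrees evenly over the residues modulo some \<open>h\<close> of order \<open>x / 4\<close>, and the
  algorithm of Kalkowski, Karonski and Pfender, with steps \<open>h\<close>, then separates the vertices sharing a residue.
\<close>

section \<open>Equidistributed colourings\<close>

text \<open>The number of vertices is not bounded in terms of \<open>d\<close>, so a union bound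
  over \<open>V\<close> cannot give the colouring; a local argument can, because the bad event at
  \<open>v\<close> only involves the \<open>d\<close> neighbours of \<open>v\<close>. The deviation
  \<open>l\<close> then dictates the range of \<beta>: weights of order \<open>x\<close> leave an
  error of order \<open>x * l\<close> at each vertex of \<open>B\<close>, to be spread over its
  roughly \<open>17 * d powr (1 - (\<beta> + e))\<close> edges into \<open>S\<close>. Each of these
  needs a slack \<open>A\<close> of order \<open>x * d powr (\<beta> + 2 * e - 1/2)\<close>, which
  is small against \<open>x / d powr \<beta>\<close> when \<beta> + e < 1/4. The numbers 17 and nine
  come from one inequality. Four multiples of \<open>h\<close> per edge fit below \<open>k\<close>
  when \<open>h\<close> is about \<open>x / 4\<close>. A class of two strips out of
  \<open>K'\<close> has about \<open>2 * n / K'\<close> vertices, hence about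
  \<open>T = 8 * d / K'\<close> per residue, and the separation asks for degree at least
  \<open>2 * (T + 1)\<close> inside \<open>S\<close>: slightly more than 16 strips provide. One
  strip for class 0 and eight pairs make 17.\<close>

lemma simple_graphD:
  assumes "simple_graph V E"
  shows "finite V" "neighbours E v \<subseteq> V" "finite (neighbours E v)" "v \<notin> neighbours E v"
    "u \<in> neighbours E v \<Longrightarrow> v \<in> neighbours E u" "u \<in> neighbours E v \<Longrightarrow> v \<in> V"
proof -
  show fin: "finite V" using assms by (simp add: simple_graph_def)
  show sub: "neighbours E v \<subseteq> V" using assms by (auto simp: simple_graph_def neighbours_def)
  show "finite (neighbours E v)" using fin sub by (rule finite_subset[rotated])
  show "v \<notin> neighbours E v" using assms by (force simp: simple_graph_def neighbours_def)
  show "u \<in> neighbours E v \<Longrightarrow> v \<in> neighbours E u"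
    by (simp add: neighbours_def insert_commute)
  show "u \<in> neighbours E v \<Longrightarrow> v \<in> V" using assms by (auto simp: simple_graph_def neighbours_def)
qed

text \<open>
  Rosenfeld's counting argument, in place of the Lovasz local lemma: adding a vertex multiplies the number
  of good partial colourings by at least \<open>ratio\<close>.
\<close>

locale local_colouring =
  fixes V :: "'a set" and K d :: nat and N :: "'a \<Rightarrow> 'a set" and Bad :: "'a \<Rightarrow> ('a \<Rightarrow> nat) set"
  assumes finite_V: "finite V" and K_pos: "0 < K" and d_pos: "0 < d"
    and N_subset: "v \<in> V \<Longrightarrow> N v \<subseteq> V" and card_N: "v \<in> V \<Longrightarrow> card (N v) = d"
    and overlap: "x \<in> V \<Longrightarrow> card {v \<in> V. x \<in> N v} \<le> d"
    and Bad_subset: "v \<in> V \<Longrightarrow> Bad v \<subseteq> N v \<rightarrow>\<^sub>E {..<K}"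
    and Bad_rare: "v \<in> V \<Longrightarrow> real (card (Bad v)) * (4 * (real d)\<^sup>2) \<le> real K ^ d"
begin

text \<open>A neighbourhood is tested only once all of it is coloured. So if a good colouring is
  extended by one vertex, every test that fails involves this vertex.\<close>

definition good :: "'a set \<Rightarrow> ('a \<Rightarrow> nat) set" where
  "good U = {f \<in> U \<rightarrow>\<^sub>E {..<K}. \<forall>v\<in>V. N v \<subseteq> U \<longrightarrow> restrict f (N v) \<notin> Bad v}"

text \<open>The loss \<open>1 / (2 * d)\<close> meets two demands: it pays for \<open>d\<close>
  events that each spoil a share \<open>1 / (2 * d\<^sup>2)\<close> of the extensions, and
  \<open>d - 1\<close> such losses together cost at most a factor 2.\<close>

definition ratio :: real where
  "ratio = (1 - 1 / (2 * real d)) * real K"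

lemma finite_good: "U \<subseteq> V \<Longrightarrow> finite (good U)"
  unfolding good_def using finite_subset[OF _ finite_V] by (simp add: finite_PiE)

lemma good_restrict: "f \<in> good U \<Longrightarrow> W \<subseteq> U \<Longrightarrow> restrict f W \<in> good W"
  unfolding good_def by (auto simp: restrict_restrict PiE_iff Int_absorb1 subset_iff)

lemma ratio_pos: "0 < ratio"
proof -
  have "1 / (2 * real d) \<le> 1 / 2" using d_pos by (simp add: field_simps)
  then have "0 < 1 - 1 / (2 * real d)" by linarith
  then show ?thesis using K_pos by (simp add: ratio_def)
qed

lemma ratio_power: "real K ^ (d - 1) \<le> 2 * ratio ^ (d - 1)"
proof -
  have "1 + real (d - 1) * (- (1 / (2 * real d))) \<le> (1 + - (1 / (2 * real d))) ^ (d - 1)"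
    by (rule Bernoulli_inequality) (use d_pos in \<open>simp add: field_simps\<close>)
  moreover have "1 / 2 \<le> 1 + real (d - 1) * (- (1 / (2 * real d)))"
    using d_pos by (simp add: field_simps of_nat_diff)
  ultimately have "1 / 2 \<le> (1 - 1 / (2 * real d)) ^ (d - 1)" by simp
  then have "1 / 2 * real K ^ (d - 1) \<le> ratio ^ (d - 1)"
    unfolding ratio_def power_mult_distrib by (intro mult_right_mono) auto
  then show ?thesis by simp
qed

text \<open>Of the \<open>K * card (good U)\<close> extensions, those that fail at \<open>v\<close>
  are determined by their bad restriction to \<open>N v\<close> and a good colouring of
  \<open>U - N v\<close>. By induction the latter are fewer than the good colourings of
  \<open>U\<close> by a factor \<open>ratio ^ (d - 1)\<close>, which makes failures rare; only
  \<open>d\<close> vertices \<open>v\<close> have \<open>x\<close> in their neighbourhood.\<close>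

lemma card_good_insert:
  assumes "insert x U \<subseteq> V" "x \<notin> U"
  shows "ratio * card (good U) \<le> card (good (insert x U))"
  using assms
proof (induction "card U" arbitrary: U x rule: less_induct)
  case less
  have finU: "finite U" using less.prems finite_V by (auto dest: finite_subset)
  \<comment> \<open>Iterates the induction hypothesis: every vertex of \<open>D\<close> is added to
    a proper subset of \<open>U\<close>.\<close>
  have chain: "ratio ^ card D * card (good W) \<le> card (good (W \<union> D))"
    if "finite D" "W \<union> D \<subseteq> U" "W \<inter> D = {}" for W D
    using that
  proof (induction D rule: finite_induct)
    case empty
    then show ?case by simp
  next
    case (insert a D)
    have "W \<union> D \<subset> U" using insert by auto
    then have "card (W \<union> D) < card U" using finU by (rule psubset_card_mono[rotated])
    then have "ratio * card (good (W \<union> D)) \<le> card (good (insert a (W \<union> D)))"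
      using insert less.prems by (intro less.hyps) auto
    moreover have "ratio ^ card D * card (good W) \<le> card (good (W \<union> D))"
      using insert by auto
    then have "ratio * (ratio ^ card D * card (good W)) \<le> ratio * card (good (W \<union> D))"
      using ratio_pos by (intro mult_left_mono) auto
    ultimately show ?case using insert by (simp add: mult.assoc)
  qed
  define X where "X = (\<lambda>(y, g). g(x := y)) ` ({..<K} \<times> good U)"
  have "inj_on (\<lambda>(y, g). g(x := y)) ({..<K} \<times> good U)"
    by (rule inj_on_subset[OF inj_combinator[OF less.prems(2), of "\<lambda>_. {..<K}"]])
      (auto simp: good_def)
  then have cardX: "card X = K * card (good U)"
    by (simp add: X_def card_image card_cartesian_product)
  define J where "J = {v \<in> V. x \<in> N v \<and> N v \<subseteq> insert x U}"
  \<comment> \<open>Goodness is kept only on \<open>U - N v\<close>, so that the two restrictions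
    can be counted independently of each other.\<close>
  define Y where "Y v = {f \<in> insert x U \<rightarrow>\<^sub>E {..<K}. restrict f (N v) \<in> Bad v \<and>
      restrict f (U - N v) \<in> good (U - N v)}" for v
  have finY: "finite (Y v)" for v
    unfolding Y_def using finU by (simp add: finite_PiE)
  have "X \<subseteq> good (insert x U) \<union> (\<Union>v\<in>J. Y v)"
  proof
    fix f assume "f \<in> X"
    then obtain y g where f: "f = g(x := y)" "y < K" "g \<in> good U" by (auto simp: X_def)
    have fE: "f \<in> insert x U \<rightarrow>\<^sub>E {..<K}" using f by (auto simp: good_def PiE_iff extensional_def)
    have res: "restrict f W = restrict g W" if "x \<notin> W" for W
      using that f by (auto simp: restrict_def)
    show "f \<in> good (insert x U) \<union> (\<Union>v\<in>J. Y v)"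
    proof (cases "f \<in> good (insert x U)")
      case False
      then obtain v where v: "v \<in> V" "N v \<subseteq> insert x U" "restrict f (N v) \<in> Bad v"
        using fE by (auto simp: good_def)
      have "x \<in> N v"
      proof (rule ccontr)
        assume "x \<notin> N v"
        then have "restrict g (N v) \<in> Bad v" "N v \<subseteq> U" using v res by auto
        then show False using f v by (auto simp: good_def)
      qed
      moreover have "restrict f (U - N v) \<in> good (U - N v)"
        using good_restrict[OF f(3), of "U - N v"] res[of "U - N v"] less.prems by auto
      ultimately show ?thesis using v fE by (auto simp: J_def Y_def)
    qed auto
  qed
  then have "card X \<le> card (good (insert x U) \<union> (\<Union>v\<in>J. Y v))"
    using finite_good[OF less.prems(1)] finY finite_V by (intro card_mono) (auto simp: J_def)
  also have "\<dots> \<le> card (good (insert x U)) + (\<Sum>v\<in>J. card (Y v))"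
    using finite_V by (intro card_Un_le[THEN order_trans] add_left_mono card_UN_le) (auto simp: J_def)
  finally have le: "real K * card (good U) \<le> card (good (insert x U)) + (\<Sum>v\<in>J. real (card (Y v)))"
    unfolding cardX by (metis of_nat_add of_nat_le_iff of_nat_mult of_nat_sum)
  \<comment> \<open>Here \<open>card (Bad v)\<close> is at most
    \<open>K ^ d / (4 * d\<^sup>2)\<close>, and \<open>good (U - N v)\<close> has at most
    \<open>2 * card (good U) / K ^ (d - 1)\<close> elements by \<open>ratio_power\<close>. Summed
    over at most \<open>d\<close> vertices this is exactly the loss in \<open>ratio\<close>.\<close>
  have Yle: "card (Y v) * (2 * (real d)\<^sup>2) \<le> real K * card (good U)" if "v \<in> J" for v
  proof -
    have v: "v \<in> V" "x \<in> N v" "N v \<subseteq> insert x U" using that by (auto simp: J_def)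
    have "card (Y v) \<le> card (Bad v \<times> good (U - N v))"
    proof (rule card_inj_on_le)
      show "inj_on (\<lambda>f. (restrict f (N v), restrict f (U - N v))) (Y v)"
      proof (rule inj_onI)
        fix f f' assume ff: "f \<in> Y v" "f' \<in> Y v"
          and eq: "(restrict f (N v), restrict f (U - N v)) = (restrict f' (N v), restrict f' (U - N v))"
        show "f = f'"
        proof (rule PiE_ext)
          show "f \<in> insert x U \<rightarrow>\<^sub>E {..<K}" "f' \<in> insert x U \<rightarrow>\<^sub>E {..<K}"
            using ff by (auto simp: Y_def)
          fix z assume "z \<in> insert x U"
          then have "z \<in> N v \<or> z \<in> U - N v" using v by auto
          then show "f z = f' z" using eq by (auto dest!: fun_cong[of _ _ z] simp: restrict_def)
        qed
      qed
      show "(\<lambda>f. (restrict f (N v), restrict f (U - N v))) ` Y v \<subseteq> Bad v \<times> good (U - N v)"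
        by (auto simp: Y_def)
      have "finite (Bad v)"
        using Bad_subset[OF v(1)] finite_subset[OF N_subset[OF v(1)] finite_V]
        by (auto intro: finite_subset finite_PiE)
      moreover have "finite (good (U - N v))" using less.prems by (intro finite_good) auto
      ultimately show "finite (Bad v \<times> good (U - N v))" by auto
    qed
    then have 1: "card (Y v) \<le> real (card (Bad v)) * card (good (U - N v))"
      by (metis card_cartesian_product of_nat_le_iff of_nat_mult)
    have "card (U \<inter> N v) = d - 1"
    proof -
      have "U \<inter> N v = N v - {x}" using v less.prems by auto
      then show ?thesis using v card_N[OF v(1)] by simp
    qed
    moreover have "ratio ^ card (U \<inter> N v) * card (good (U - N v)) \<le> card (good ((U - N v) \<union> (U \<inter> N v)))"
      using finU by (intro chain) auto
    moreover have "(U - N v) \<union> (U \<inter> N v) = U" by auto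
    ultimately have 2: "ratio ^ (d - 1) * card (good (U - N v)) \<le> card (good U)" by simp
    have "card (Y v) * (4 * (real d)\<^sup>2) \<le> real (card (Bad v)) * card (good (U - N v)) * (4 * (real d)\<^sup>2)"
      using 1 by (intro mult_right_mono) auto
    also have "\<dots> = real (card (Bad v)) * (4 * (real d)\<^sup>2) * card (good (U - N v))" by simp
    also have "\<dots> \<le> real K ^ d * card (good (U - N v))"
      using Bad_rare[OF v(1)] by (intro mult_right_mono) auto
    also have "\<dots> = real K * (real K ^ (d - 1) * card (good (U - N v)))"
      using d_pos by (simp add: power_eq_if)
    also have "\<dots> \<le> real K * (2 * ratio ^ (d - 1) * card (good (U - N v)))"
      using ratio_power by (intro mult_left_mono mult_right_mono) auto
    also have "\<dots> \<le> real K * (2 * card (good U))"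
      using 2 by (intro mult_left_mono) auto
    finally show ?thesis by simp
  qed
  have "card J \<le> d"
    using overlap[of x] less.prems finite_V
    by (intro order_trans[OF card_mono overlap]) (auto simp: J_def)
  have "(\<Sum>v\<in>J. real (card (Y v))) \<le> (\<Sum>v\<in>J. real K * card (good U) / (2 * (real d)\<^sup>2))"
    using Yle d_pos by (intro sum_mono) (simp add: pos_le_divide_eq)
  also have "\<dots> = card J * (real K * card (good U) / (2 * (real d)\<^sup>2))" by simp
  also have "\<dots> \<le> d * (real K * card (good U) / (2 * (real d)\<^sup>2))"
    using \<open>card J \<le> d\<close> by (intro mult_right_mono) auto
  also have "\<dots> = real K * card (good U) / (2 * d)"
    using d_pos by (simp add: power2_eq_square)
  finally show ?case using le by (simp add: ratio_def field_simps)
qed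

lemma card_good_pos:
  assumes "U \<subseteq> V" shows "0 < card (good U)"
proof -
  have "finite U" using assms finite_V by (rule finite_subset)
  then show ?thesis using assms
  proof (induction U rule: finite_induct)
    case empty
    have "N v \<noteq> {}" if "v \<in> V" for v using card_N[OF that] d_pos by auto
    then have "good {} = {\<lambda>_. undefined}" by (auto simp: good_def)
    then show ?case by simp
  next
    case (insert x U)
    then have "0 < ratio * card (good U)" using ratio_pos by auto
    also have "\<dots> \<le> card (good (insert x U))" using insert by (intro card_good_insert) auto
    finally show ?case by simp
  qed
qed

lemma colouring_exists:
  "\<exists>f. f \<in> V \<rightarrow>\<^sub>E {..<K} \<and> (\<forall>v\<in>V. restrict f (N v) \<notin> Bad v)"
proof -
  obtain f where "f \<in> good V"
    using card_good_pos[of V] by (metis card_gt_0_iff ex_in_conv subset_refl)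
  then show ?thesis using N_subset by (intro exI[of _ f]) (auto simp: good_def)
qed

end

section \<open>Exponential moments and large deviations, with sums over all colourings in place of
  expectations\<close>

lemma exp_le_quadratic:
  fixes x :: real assumes "\<bar>x\<bar> \<le> 1" shows "exp x \<le> 1 + x + x\<^sup>2"
proof (cases "0 \<le> x")
  case True
  then show ?thesis using assms by (intro exp_bound) auto
next
  case False
  define y where "y = - x"
  have y: "0 < y" "y \<le> 1" using False assms by (auto simp: y_def)
  \<comment> \<open>The product equals \<open>1 + y ^ 3\<close>.\<close>
  have "1 \<le> (1 - y + y\<^sup>2) * (1 + y)"
    using y by (simp add: algebra_simps power2_eq_square)
  also have "\<dots> \<le> (1 - y + y\<^sup>2) * exp y"
    using y by (intro mult_left_mono) (auto simp: exp_ge_add_one_self)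
  finally have "exp (- y) \<le> 1 - y + y\<^sup>2"
    by (simp add: exp_minus field_simps)
  then show ?thesis by (simp add: y_def)
qed

text \<open>The sum over all colourings factors over the vertices of \<open>N\<close>. In each
  factor the linear term cancels because \<open>t / K\<close> is the mean of the indicator, and the
  quadratic term is at most \<open>s\<^sup>2\<close>.\<close>

lemma exp_moment_bound:
  fixes s :: real and t K :: nat
  assumes "finite N" "t \<le> K" "0 < K" "\<bar>s\<bar> \<le> 1"
  shows "(\<Sum>f\<in>N \<rightarrow>\<^sub>E {..<K}. exp (s * (real (card {u \<in> N. f u < t}) - card N * (t / K))))
    \<le> exp (card N * s\<^sup>2) * real K ^ card N"
proof -
  define p where "p = real t / real K"
  have p: "0 \<le> p" "p \<le> 1" using assms by (auto simp: p_def)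
  have "(\<Sum>f\<in>N \<rightarrow>\<^sub>E {..<K}. exp (s * (real (card {u \<in> N. f u < t}) - card N * (t / K))))
    = (\<Sum>f\<in>N \<rightarrow>\<^sub>E {..<K}. \<Prod>u\<in>N. exp (s * (of_bool (f u < t) - p)))"
  proof (rule sum.cong)
    fix f
    have "real (card {u \<in> N. f u < t}) = (\<Sum>u\<in>N. of_bool (f u < t))"
      using assms by (simp add: Int_def)
    then have "s * (real (card {u \<in> N. f u < t}) - card N * (t / K)) = (\<Sum>u\<in>N. s * (of_bool (f u < t) - p))"
      by (simp add: sum_subtractf sum_distrib_left[symmetric] p_def)
    then show "exp (s * (real (card {u \<in> N. f u < t}) - card N * (t / K)))
      = (\<Prod>u\<in>N. exp (s * (of_bool (f u < t) - p)))"
      using assms by (simp add: exp_sum)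
  qed simp
  also have "\<dots> = (\<Prod>u\<in>N. \<Sum>q\<in>{..<K}. exp (s * (of_bool (q < t) - p)))"
    using assms by (subst prod_sum_PiE) auto
  also have "\<dots> \<le> (\<Prod>u\<in>N. real K * exp (s\<^sup>2))"
  proof (rule prod_mono, intro conjI)
    fix u
    show "0 \<le> (\<Sum>q\<in>{..<K}. exp (s * (of_bool (q < t) - p)))" by (intro sum_nonneg) auto
    have "(\<Sum>q\<in>{..<K}. exp (s * (of_bool (q < t) - p)))
      \<le> (\<Sum>q\<in>{..<K}. 1 + s * (of_bool (q < t) - p) + (s * (of_bool (q < t) - p))\<^sup>2)"
    proof (rule sum_mono, rule exp_le_quadratic)
      fix q
      have "\<bar>of_bool (q < t) - p\<bar> \<le> 1" using p by auto
      then show "\<bar>s * (of_bool (q < t) - p)\<bar> \<le> 1"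
        using assms(4) by (simp add: abs_mult mult_le_one)
    qed
    also have "\<dots> \<le> (\<Sum>q\<in>{..<K}. 1 + s * (of_bool (q < t) - p) + s\<^sup>2)"
    proof (rule sum_mono)
      fix q
      have "\<bar>of_bool (q < t) - p\<bar> \<le> 1" using p by auto
      then have "(of_bool (q < t) - p)\<^sup>2 \<le> 1" by (simp add: abs_square_le_1)
      then have "s\<^sup>2 * (of_bool (q < t) - p)\<^sup>2 \<le> s\<^sup>2 * 1" by (intro mult_left_mono) auto
      then show "1 + s * (of_bool (q < t) - p) + (s * (of_bool (q < t) - p))\<^sup>2
        \<le> 1 + s * (of_bool (q < t) - p) + s\<^sup>2" by (simp add: power_mult_distrib)
    qed
    also have "\<dots> = real K * (1 + s\<^sup>2) + s * ((\<Sum>q\<in>{..<K}. of_bool (q < t)) - K * p)"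
      by (simp add: sum.distrib sum_subtractf sum_distrib_left[symmetric] algebra_simps)
    also have "(\<Sum>q\<in>{..<K}. of_bool (q < t)) = real t"
    proof -
      have "{..<K} \<inter> {q. q < t} = {..<t}" using assms by auto
      then show ?thesis by simp
    qed
    also have "real t - K * p = 0" using assms by (simp add: p_def)
    also have "real K * (1 + s\<^sup>2) + s * 0 \<le> real K * exp (s\<^sup>2)"
      using exp_ge_add_one_self[of "s\<^sup>2"] by (simp add: mult_left_mono)
    finally show "(\<Sum>q\<in>{..<K}. exp (s * (of_bool (q < t) - p))) \<le> real K * exp (s\<^sup>2)" .
  qed
  also have "\<dots> = exp (card N * s\<^sup>2) * real K ^ card N"
    by (simp add: power_mult_distrib exp_of_nat_mult)
  finally show ?thesis .
qed

text \<open>Chernoff's argument for both tails. The choice \<open>s = l / (2 * d)\<close> minimises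
  \<open>d * s\<^sup>2 - s * l\<close>, with value \<open>- (l\<^sup>2 / (4 * d))\<close>; the bound
  on \<open>l\<close> keeps \<open>s\<close> in the range of the moment estimate.\<close>

lemma card_large_deviation:
  fixes l :: real and t K :: nat
  assumes "finite N" "t \<le> K" "0 < K" "0 < l" "l \<le> 2 * card N"
  shows "real (card {f \<in> N \<rightarrow>\<^sub>E {..<K}. l < \<bar>real (card {u \<in> N. f u < t}) - card N * (t / K)\<bar>})
    \<le> 2 * exp (- (l\<^sup>2 / (4 * card N))) * real K ^ card N"
proof -
  define d where "d = real (card N)"
  define dev where "dev f = real (card {u \<in> N. f u < t}) - d * (t / K)" for f :: "'a \<Rightarrow> nat"
  define s where "s = l / (2 * d)"
  have d: "0 < d" using assms by (auto simp: d_def)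
  have s: "0 < s" "\<bar>s\<bar> \<le> 1" "\<bar>- s\<bar> \<le> 1" using assms d by (auto simp: s_def d_def field_simps)
  let ?P = "N \<rightarrow>\<^sub>E {..<K}"
  have fin: "finite ?P" using assms by (auto intro: finite_PiE)
  let ?D = "{f \<in> ?P. l < \<bar>dev f\<bar>}"
  have "real (card ?D) * exp (s * l) = (\<Sum>f\<in>?D. exp (s * l))" by simp
  also have "\<dots> \<le> (\<Sum>f\<in>?D. exp (s * dev f) + exp (- s * dev f))"
  proof (rule sum_mono)
    fix f assume "f \<in> ?D"
    then consider "l \<le> dev f" | "l \<le> - dev f" by force
    then show "exp (s * l) \<le> exp (s * dev f) + exp (- s * dev f)"
    proof cases
      case 1
      then have "exp (s * l) \<le> exp (s * dev f)" using s by simp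
      then show ?thesis using exp_gt_zero[of "- s * dev f"] by linarith
    next
      case 2
      then have "s * l \<le> s * (- dev f)" using s by (intro mult_left_mono) auto
      then have "exp (s * l) \<le> exp (- s * dev f)" by simp
      then show ?thesis using exp_gt_zero[of "s * dev f"] by linarith
    qed
  qed
  also have "\<dots> \<le> (\<Sum>f\<in>?P. exp (s * dev f) + exp (- s * dev f))"
    using fin by (intro sum_mono2) (auto simp: add_nonneg_nonneg)
  also have "\<dots> = (\<Sum>f\<in>?P. exp (s * dev f)) + (\<Sum>f\<in>?P. exp (- s * dev f))"
    by (rule sum.distrib)
  also have "\<dots> \<le> exp (d * s\<^sup>2) * real K ^ card N + exp (d * (- s)\<^sup>2) * real K ^ card N"
    unfolding dev_def d_def using assms s by (intro add_mono exp_moment_bound) auto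
  finally have "real (card ?D) * exp (s * l) \<le> 2 * exp (d * s\<^sup>2) * real K ^ card N" by (simp add: mult_ac)
  then have "real (card ?D) \<le> 2 * exp (d * s\<^sup>2) * real K ^ card N / exp (s * l)"
    by (simp add: pos_le_divide_eq)
  then have "real (card ?D) \<le> 2 * (exp (d * s\<^sup>2) * exp (- (s * l))) * real K ^ card N"
    by (simp add: exp_minus divide_inverse mult_ac)
  also have "exp (d * s\<^sup>2) * exp (- (s * l)) = exp (- (l\<^sup>2 / (4 * d)))"
    using d by (simp add: exp_add[symmetric] s_def power2_eq_square field_simps)
  finally show ?thesis by (simp add: dev_def d_def)
qed

text \<open>The event at \<open>v\<close> is the union over the \<open>K + 1\<close> thresholds
  \<open>t\<close>; by symmetry of adjacency a vertex lies in exactly \<open>d\<close>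
  neighbourhoods. \<open>rare\<close> is the union bound at a single vertex, as the counting
  argument requires it.\<close>

lemma balanced_colouring:
  fixes l :: real and d K :: nat
  assumes reg: "regular_graph d V E" and "0 < d" "0 < K" "0 < l" "l \<le> 2 * d"
    and rare: "(K + 1) * (2 * exp (- (l\<^sup>2 / (4 * d)))) * (4 * (real d)\<^sup>2) \<le> 1"
  shows "\<exists>c. (\<forall>v\<in>V. c v < K) \<and> (\<forall>v\<in>V. \<forall>t\<le>K.
    \<bar>real (card {u \<in> neighbours E v. c u < t}) - d * (t / K)\<bar> \<le> l)"
proof -
  have sg: "simple_graph V E" and deg: "\<And>v. v \<in> V \<Longrightarrow> card (neighbours E v) = d"
    using reg by (auto simp: regular_graph_def)
  note sgD = simple_graphD[OF sg]
  define dev where "dev N f t = \<bar>real (card {u \<in> N. f u < t}) - d * (t / K)\<bar>"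
    for N and f :: "'a \<Rightarrow> nat" and t :: nat
  define Bad where "Bad v = {f \<in> neighbours E v \<rightarrow>\<^sub>E {..<K}. \<exists>t\<le>K. l < dev (neighbours E v) f t}" for v
  have "local_colouring V K d (neighbours E) Bad"
  proof
    fix x assume "x \<in> V"
    have "{v \<in> V. x \<in> neighbours E v} = neighbours E x" using sgD by blast
    then show "card {v \<in> V. x \<in> neighbours E v} \<le> d" using deg \<open>x \<in> V\<close> by simp
  next
    fix v assume v: "v \<in> V"
    define N where "N = neighbours E v"
    have N: "finite N" "card N = d" using sgD deg v by (auto simp: N_def)
    define D where "D t = {f \<in> N \<rightarrow>\<^sub>E {..<K}. l < dev N f t}" for t
    have "Bad v = (\<Union>t\<in>{..K}. D t)" by (auto simp: Bad_def D_def N_def)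
    then have "card (Bad v) \<le> (\<Sum>t\<in>{..K}. card (D t))" by (simp add: card_UN_le)
    then have "real (card (Bad v)) \<le> (\<Sum>t\<in>{..K}. real (card (D t)))"
      by (metis of_nat_le_iff of_nat_sum)
    also have "\<dots> \<le> (\<Sum>t\<in>{..K}. 2 * exp (- (l\<^sup>2 / (4 * d))) * real K ^ d)"
    proof (rule sum_mono)
      fix t assume "t \<in> {..K}"
      then show "real (card (D t)) \<le> 2 * exp (- (l\<^sup>2 / (4 * d))) * real K ^ d"
        using card_large_deviation[of N t K l] N assms by (simp add: D_def dev_def)
    qed
    also have "\<dots> = (K + 1) * (2 * exp (- (l\<^sup>2 / (4 * d)))) * real K ^ d" by simp
    finally have "real (card (Bad v)) * (4 * (real d)\<^sup>2)
      \<le> (K + 1) * (2 * exp (- (l\<^sup>2 / (4 * d)))) * real K ^ d * (4 * (real d)\<^sup>2)"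
      by (intro mult_right_mono) auto
    also have "\<dots> = (K + 1) * (2 * exp (- (l\<^sup>2 / (4 * d)))) * (4 * (real d)\<^sup>2) * real K ^ d"
      by (simp add: mult_ac)
    also have "\<dots> \<le> 1 * real K ^ d" using rare by (intro mult_right_mono) auto
    finally show "real (card (Bad v)) * (4 * (real d)\<^sup>2) \<le> real K ^ d" by simp
  qed (use sgD(1,2) deg assms in \<open>auto simp: Bad_def\<close>)
  from local_colouring.colouring_exists[OF this] obtain f where
    f: "f \<in> V \<rightarrow>\<^sub>E {..<K}" "\<And>v. v \<in> V \<Longrightarrow> restrict f (neighbours E v) \<notin> Bad v" by blast
  have "dev (neighbours E v) f t \<le> l" if "v \<in> V" "t \<le> K" for v t
  proof -
    have "restrict f (neighbours E v) \<in> neighbours E v \<rightarrow>\<^sub>E {..<K}"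
      using f(1) sgD(2)[of v] by (auto simp: PiE_iff)
    then have "dev (neighbours E v) (restrict f (neighbours E v)) t \<le> l"
      using f(2)[OF that(1)] that(2) by (auto simp: Bad_def not_less)
    moreover have "{u \<in> neighbours E v. restrict f (neighbours E v) u < t} = {u \<in> neighbours E v. f u < t}"
      by auto
    ultimately show ?thesis by (simp add: dev_def)
  qed
  then show ?thesis using f(1) by (intro exI[of _ f]) (auto simp: dev_def)
qed

section \<open>Separating vertices with the same residue\<close>

text \<open>Terms of the sign of \<open>z\<close> alone suffice, so the subset sums fill the whole
  interval between their extremes.\<close>

lemma signed_subset_sum:
  fixes s :: "'a \<Rightarrow> int"
  assumes "finite N" and s: "\<And>u. s u = 1 \<or> s u = -1"
    and z: "- int (card {u \<in> N. s u = -1}) \<le> z" "z \<le> int (card {u \<in> N. s u = 1})"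
  shows "\<exists>D\<subseteq>N. (\<Sum>u\<in>D. s u) = z"
proof (cases "0 \<le> z")
  case True
  then have "nat z \<le> card {u \<in> N. s u = 1}" using z by auto
  then obtain D where D: "D \<subseteq> {u \<in> N. s u = 1}" "card D = nat z"
    by (meson obtain_subset_with_card_n)
  then have "(\<Sum>u\<in>D. s u) = (\<Sum>u\<in>D. 1)" by (intro sum.cong) auto
  then show ?thesis using D True by (intro exI[of _ D]) auto
next
  case False
  then have "nat (- z) \<le> card {u \<in> N. s u = -1}" using z by auto
  then obtain D where D: "D \<subseteq> {u \<in> N. s u = -1}" "card D = nat (- z)"
    by (meson obtain_subset_with_card_n)
  then have "(\<Sum>u\<in>D. s u) = (\<Sum>u\<in>D. -1)" by (intro sum.cong) auto
  then show ?thesis using D False by (intro exI[of _ D]) auto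
qed

text \<open>
  Vertices are treated one at a time. A treated vertex \<open>u\<close> keeps its sum in a fixed pair
  \<open>{2a, 2a + 1}\<close>; exactly one of the moves \<open>+1\<close>, \<open>-1\<close> on an edge at \<open>u\<close> respects this.
  Hence every edge at a new vertex still has one free move, and these moves reach an interval of
  sums that is longer than the set of forbidden pairs.
\<close>

lemma distinct_halves:
  fixes \<sigma> :: "'a \<Rightarrow> int"
  assumes sg: "simple_graph S F" and deg: "\<And>v. v \<in> S \<Longrightarrow> 2 * T \<le> card (neighbours F v)"
    and cls: "\<And>v. v \<in> S \<Longrightarrow> card {u \<in> S. key u = key v} \<le> T"
    and "P \<subseteq> S"
  shows "\<exists>g :: 'a set \<Rightarrow> int. (\<forall>e\<in>F. g e \<in> {-1..2}) \<and> (\<forall>e\<in>F. e \<inter> P = {} \<longrightarrow> g e = 0) \<and>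
    (\<forall>u\<in>P. \<forall>v. v \<notin> P \<longrightarrow> {u, v} \<in> F \<longrightarrow> g {u, v} \<in> {0, 1}) \<and>
    (\<forall>u\<in>P. \<forall>v\<in>P. u \<noteq> v \<longrightarrow> key u = key v \<longrightarrow>
      (\<sigma> u + (\<Sum>w\<in>neighbours F u. g {w, u})) div 2 \<noteq> (\<sigma> v + (\<Sum>w\<in>neighbours F v. g {w, v})) div 2)"
proof -
  note sgD = simple_graphD[OF sg]
  have "finite P" using \<open>P \<subseteq> S\<close> sgD(1) by (rule finite_subset)
  then show ?thesis using \<open>P \<subseteq> S\<close>
  proof (induction P rule: finite_induct)
    case empty
    show ?case by (rule exI[of _ "\<lambda>_. 0"]) auto
  next
    case (insert v P)
    define sm where "sm g u = \<sigma> u + (\<Sum>w\<in>neighbours F u. g {w, u})" for g and u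
    have "P \<subseteq> S" using insert by auto
    from insert.IH[OF this, folded sm_def] obtain g where gE: "\<forall>e\<in>F. g e \<in> {-1..2}" "\<forall>e\<in>F. e \<inter> P = {} \<longrightarrow> g e = 0"
      "\<forall>u\<in>P. \<forall>w. w \<notin> P \<longrightarrow> {u, w} \<in> F \<longrightarrow> g {u, w} \<in> {0, 1}"
      "\<forall>u\<in>P. \<forall>w\<in>P. u \<noteq> w \<longrightarrow> key u = key w \<longrightarrow> sm g u div 2 \<noteq> sm g w div 2"
      by (elim exE conjE) (rule that)
    note g = gE[rule_format]
    have vS: "v \<in> S" using insert by auto
    define N where "N = neighbours F v"
    have N: "finite N" "v \<notin> N" using sgD by (auto simp: N_def)
    \<comment> \<open>The free move at \<open>u\<close>: up from an even sum, down from an odd one,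
      so a treated \<open>u\<close> stays in its pair. For an untreated \<open>u\<close> the edge
      still has value 0 and moves up.\<close>
    define s where "s u = (if u \<in> P \<and> odd (sm g u) then - 1 else 1 :: int)" for u
    define neg where "neg = int (card {u \<in> N. s u = -1})"
    define pos where "pos = int (card {u \<in> N. s u = 1})"
    have "card N = card ({u \<in> N. s u = -1} \<union> {u \<in> N. s u = 1})"
      by (rule arg_cong[of _ _ card]) (auto simp: s_def)
    also have "\<dots> = card {u \<in> N. s u = -1} + card {u \<in> N. s u = 1}"
      using N by (intro card_Un_disjoint) auto
    finally have "card N = card {u \<in> N. s u = -1} + card {u \<in> N. s u = 1}" .
    then have np: "2 * int T \<le> neg + pos"
      using deg[OF vS] by (simp add: neg_def pos_def N_def)
    define Blocked where "Blocked = (\<lambda>u. sm g u div 2) ` {u \<in> P. key u = key v}"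
    have "card Blocked \<le> card {u \<in> P. key u = key v}"
      unfolding Blocked_def using insert by (intro card_image_le) auto
    also have "\<dots> < card {u \<in> S. key u = key v}"
      using insert sgD(1) by (intro psubset_card_mono) auto
    also have "\<dots> \<le> T" using cls[OF vS] .
    finally have Bl: "int (card Blocked) < int T" by simp
    \<comment> \<open>The reachable sums form an interval of length \<open>neg + pos\<close>, at
      least \<open>2 * T\<close>, so these \<open>w\<close> number at least \<open>T\<close>, and
      \<open>2 * w\<close> is reachable for each. Fewer than \<open>T\<close> pairs are blocked
      since \<open>v\<close> itself belongs to its class of at most \<open>T\<close>
      vertices.\<close>
    have "\<exists>w\<in>{(sm g v - neg) div 2 + 1..(sm g v + pos) div 2}. w \<notin> Blocked"
    proof (rule ccontr)
      assume "\<not> ?thesis"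
      then have "{(sm g v - neg) div 2 + 1..(sm g v + pos) div 2} \<subseteq> Blocked" by auto
      then have "card {(sm g v - neg) div 2 + 1..(sm g v + pos) div 2} \<le> card Blocked"
        using insert by (intro card_mono) (auto simp: Blocked_def)
      then have "(sm g v + pos) div 2 - (sm g v - neg) div 2 < T" using Bl by auto
      then show False using np by linarith
    qed
    then obtain w where w: "(sm g v - neg) div 2 + 1 \<le> w" "w \<le> (sm g v + pos) div 2" "w \<notin> Blocked"
      by auto
    have "\<exists>D\<subseteq>N. (\<Sum>u\<in>D. s u) = 2 * w - sm g v"
    proof (rule signed_subset_sum[OF N(1)])
      show "s u = 1 \<or> s u = -1" for u by (simp add: s_def)
      show "- int (card {u \<in> N. s u = -1}) \<le> 2 * w - sm g v"
        using w(1) unfolding neg_def[symmetric] by linarith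
      show "2 * w - sm g v \<le> int (card {u \<in> N. s u = 1})"
        using w(2) unfolding pos_def[symmetric] by linarith
    qed
    then obtain D where D: "D \<subseteq> N" "(\<Sum>u\<in>D. s u) = 2 * w - sm g v" by blast
    define g' where "g' e = g e + (if v \<in> e \<and> e - {v} \<subseteq> D then s (the_elem (e - {v})) else 0)" for e
    have g'v: "g' {u, v} = g {u, v} + (if u \<in> D then s u else 0)" if "u \<noteq> v" for u
    proof -
      have "{u, v} - {v} = {u}" using that by auto
      then show ?thesis by (simp add: g'_def)
    qed
    have g'o: "g' e = g e" if "v \<notin> e" for e using that by (simp add: g'_def)
    have edge: "\<exists>u\<in>N. e = {u, v}" if e: "e \<in> F" "v \<in> e" for e
    proof -
      have "card e = 2" using sg e by (auto simp: simple_graph_def)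
      then obtain a b where "e = {a, b}" "a \<noteq> b" by (meson card_2_iff)
      then show ?thesis using e by (auto simp: N_def neighbours_def insert_commute)
    qed
    have smv: "sm g' v = 2 * w"
    proof -
      have "(\<Sum>u\<in>N. g' {u, v}) = (\<Sum>u\<in>N. g {u, v} + (if u \<in> D then s u else 0))"
        using N by (intro sum.cong refl g'v) auto
      also have "\<dots> = (\<Sum>u\<in>N. g {u, v}) + (\<Sum>u\<in>N \<inter> D. s u)"
        using N by (simp add: sum.distrib sum.inter_restrict)
      also have "N \<inter> D = D" using D by auto
      finally show ?thesis using D by (simp add: sm_def N_def)
    qed
    have smu: "sm g' u = sm g u + (if u \<in> D then s u else 0)" if "u \<noteq> v" for u
    proof -
      have "(\<Sum>w\<in>neighbours F u. g' {w, u}) =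
        (\<Sum>w\<in>neighbours F u. g {w, u} + (if w = v then if u \<in> D then s u else 0 else 0))"
      proof (rule sum.cong)
        fix w assume "w \<in> neighbours F u"
        then have "w \<noteq> u" using sgD(4) by metis
        show "g' {w, u} = g {w, u} + (if w = v then if u \<in> D then s u else 0 else 0)"
        proof (cases "w = v")
          case True
          then show ?thesis using g'v[OF that] by (simp add: insert_commute)
        next
          case False
          then show ?thesis using g'o[of "{w, u}"] that by auto
        qed
      qed simp
      also have "\<dots> = (\<Sum>w\<in>neighbours F u. g {w, u}) + (if u \<in> D then s u else 0)"
        using D(1) sgD(3,5) by (auto simp: sum.distrib sum.delta N_def)
      finally show ?thesis by (simp add: sm_def)
    qed
    have half: "sm g' u div 2 = sm g u div 2" if "u \<in> P" for u
    proof -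
      have "u \<noteq> v" using that insert by auto
      then show ?thesis using smu[of u] that by (auto simp: s_def) presburger+
    qed
    show ?case
    proof (intro exI[of _ g'] conjI ballI allI impI)
      fix e assume e: "e \<in> F"
      show "g' e \<in> {-1..2}"
      proof (cases "v \<in> e")
        case True
        then obtain u where u: "u \<in> N" "e = {u, v}" using edge e by blast
        then have "u \<noteq> v" using N by auto
        \<comment> \<open>An edge changes at most twice, when each of its ends is treated. Before
          the treatment of its second end it is 0 or 1, and a last move by one leaves it between -1
          and 2.\<close>
        have "g {u, v} \<in> {0, 1}"
        proof (cases "u \<in> P")
          case True
          then show ?thesis using g(3)[of u v] u e insert by auto
        next
          case False
          then show ?thesis using g(2)[of e] u e insert by auto
        qed
        then show ?thesis using g'v[OF \<open>u \<noteq> v\<close>] u by (auto simp: s_def)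
      qed (use g(1) g'o e in auto)
      show "g' e = 0" if "e \<inter> insert v P = {}"
        using that g(2)[OF e] g'o[of e] by auto
    next
      fix u x assume ux: "u \<in> insert v P" "x \<notin> insert v P" "{u, x} \<in> F"
      show "g' {u, x} \<in> {0, 1}"
      proof (cases "u = v")
        case True
        have "g {x, v} = 0" using g(2)[of "{x, v}"] ux True insert by (auto simp: insert_commute)
        moreover have "s x = 1" using ux by (simp add: s_def)
        ultimately show ?thesis using g'v[of x] ux True by (auto simp: insert_commute)
      next
        case False
        then show ?thesis using ux g(3)[of u x] g'o[of "{u, x}"] by auto
      qed
    next
      fix u x assume ux: "u \<in> insert v P" "x \<in> insert v P" "u \<noteq> x" "key u = key x"
      have "sm g' u div 2 \<noteq> sm g' x div 2"
      proof (cases "u = v \<or> x = v")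
        case True
        have "w \<noteq> sm g y div 2" if "y \<in> P" "key y = key v" for y
          using w(3) that by (auto simp: Blocked_def)
        then show ?thesis using True ux smv half by (metis insertE nonzero_mult_div_cancel_left zero_neq_numeral)
      next
        case False
        then show ?thesis using ux half g(4) by auto
      qed
      then show "(\<sigma> u + (\<Sum>w\<in>neighbours F u. g' {w, u})) div 2 \<noteq> (\<sigma> x + (\<Sum>w\<in>neighbours F x. g' {w, x})) div 2"
        by (simp add: sm_def)
    qed
  qed
qed

text \<open>Adding 1 to every edge turns the range -1..2 into 0..3. This shifts each sum by the
  degree of its vertex, so the degrees are included in \<sigma> beforehand.\<close>

lemma distinct_sums_on_classes:
  fixes \<sigma> :: "'a \<Rightarrow> int"
  assumes sg: "simple_graph S F" and deg: "\<And>v. v \<in> S \<Longrightarrow> 2 * T \<le> card (neighbours F v)"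
    and cls: "\<And>v. v \<in> S \<Longrightarrow> card {u \<in> S. key u = key v} \<le> T"
  shows "\<exists>g :: 'a set \<Rightarrow> int. (\<forall>e\<in>F. g e \<in> {0..3}) \<and>
    (\<forall>u\<in>S. \<forall>v\<in>S. u \<noteq> v \<longrightarrow> key u = key v \<longrightarrow>
      \<sigma> u + (\<Sum>w\<in>neighbours F u. g {w, u}) \<noteq> \<sigma> v + (\<Sum>w\<in>neighbours F v. g {w, v}))"
proof -
  obtain g :: "'a set \<Rightarrow> int" where g: "\<forall>e\<in>F. g e \<in> {-1..2}"
    "\<forall>u\<in>S. \<forall>v\<in>S. u \<noteq> v \<longrightarrow> key u = key v \<longrightarrow>
      (\<sigma> u + card (neighbours F u) + (\<Sum>w\<in>neighbours F u. g {w, u})) div 2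
      \<noteq> (\<sigma> v + card (neighbours F v) + (\<Sum>w\<in>neighbours F v. g {w, v})) div 2"
    using distinct_halves[OF sg deg cls subset_refl, where \<sigma> = "\<lambda>u. \<sigma> u + card (neighbours F u)"]
    by blast
  have "(\<Sum>w\<in>neighbours F u. g {w, u} + 1) = card (neighbours F u) + (\<Sum>w\<in>neighbours F u. g {w, u})" for u
    by (simp add: sum.distrib)
  then show ?thesis
    using g by (intro exI[of _ "\<lambda>e. g e + 1"]) (force simp: add.assoc)
qed

section \<open>Balancing residues\<close>

lemma heavy_fibres:
  fixes r :: "'a \<Rightarrow> int"
  assumes "finite U" "finite R"
  shows "T * card {\<rho> \<in> R. T \<le> card {u \<in> U. r u = \<rho>}} \<le> card U"
proof -
  let ?H = "{\<rho> \<in> R. T \<le> card {u \<in> U. r u = \<rho>}}"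
  have "T * card ?H = (\<Sum>\<rho>\<in>?H. T)" by simp
  also have "\<dots> \<le> (\<Sum>\<rho>\<in>?H. card {u \<in> U. r u = \<rho>})" by (intro sum_mono) auto
  also have "\<dots> = card (\<Union>\<rho>\<in>?H. {u \<in> U. r u = \<rho>})"
    using assms by (subst card_UN_disjoint) auto
  also have "\<dots> \<le> card U" using assms by (intro card_mono) auto
  finally show ?thesis .
qed

text \<open>Greedy: when \<open>v\<close> is placed, fewer than \<open>T * h\<close> members of its
  class are placed already, so one of the \<open>h\<close> residues is taken by fewer than
  \<open>T\<close> of them.\<close>

lemma balanced_assignment:
  fixes h T :: nat and cls :: "'a \<Rightarrow> 'b"
  assumes "finite U" "\<And>j. card {u \<in> U. cls u = j} \<le> T * h"
  shows "\<exists>r :: 'a \<Rightarrow> int. (\<forall>u\<in>U. 0 \<le> r u \<and> r u < h) \<and> (\<forall>j \<rho>. card {u \<in> U. cls u = j \<and> r u = \<rho>} \<le> T)"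
  using assms
proof (induction U rule: finite_induct)
  case empty
  then show ?case by auto
next
  case (insert v U)
  have "card {u \<in> U. cls u = j} \<le> T * h" for j
    using insert.hyps by (intro order_trans[OF card_mono insert.prems[of j]]) auto
  then obtain r :: "'a \<Rightarrow> int" where r: "\<forall>u\<in>U. 0 \<le> r u \<and> r u < h"
    "\<And>j \<rho>. card {u \<in> U. cls u = j \<and> r u = \<rho>} \<le> T"
    using insert.IH by auto
  define U' where "U' = {u \<in> U. cls u = cls v}"
  have U': "finite U'" using insert by (simp add: U'_def)
  have "card U' < card {u \<in> insert v U. cls u = cls v}"
    using insert by (intro psubset_card_mono) (auto simp: U'_def)
  also have "\<dots> \<le> T * h" using insert.prems .
  finally have lt: "card U' < T * h" .
  have "\<exists>\<rho>\<in>{0..<int h}. card {u \<in> U'. r u = \<rho>} < T"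
  proof (rule ccontr)
    assume "\<not> ?thesis"
    then have "{\<rho> \<in> {0..<int h}. T \<le> card {u \<in> U'. r u = \<rho>}} = {0..<int h}"
      by (auto simp: not_less)
    then show False using heavy_fibres[OF U', of "{0..<int h}" T r] lt by simp
  qed
  then obtain \<rho> where \<rho>': "\<rho> \<in> {0..<int h}" "card {u \<in> U'. r u = \<rho>} < T" by blast
  moreover have "{u \<in> U'. r u = \<rho>} = {u \<in> U. cls u = cls v \<and> r u = \<rho>}" by (auto simp: U'_def)
  ultimately have \<rho>: "0 \<le> \<rho>" "\<rho> < h" "card {u \<in> U. cls u = cls v \<and> r u = \<rho>} < T" by auto
  show ?case
  proof (intro exI[of _ "r(v := \<rho>)"] conjI allI)
    show "\<forall>u\<in>insert v U. 0 \<le> (r(v := \<rho>)) u \<and> (r(v := \<rho>)) u < int h" using r \<rho> by auto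
    fix j \<rho>'
    have fin: "finite {u \<in> U. cls u = j \<and> r u = \<rho>'}" using insert by simp
    show "card {u \<in> insert v U. cls u = j \<and> (r(v := \<rho>)) u = \<rho>'} \<le> T"
    proof (cases "cls v = j \<and> \<rho> = \<rho>'")
      case True
      then have "{u \<in> insert v U. cls u = j \<and> (r(v := \<rho>)) u = \<rho>'} = insert v {u \<in> U. cls u = j \<and> r u = \<rho>'}"
        using insert by auto
      then show ?thesis using True \<rho>(3) fin insert by auto
    next
      case False
      then have "{u \<in> insert v U. cls u = j \<and> (r(v := \<rho>)) u = \<rho>'} = {u \<in> U. cls u = j \<and> r u = \<rho>'}"
        using insert by auto
      then show ?thesis using r(2) by simp
    qed
  qed
qed

text \<open>As \<open>\<pi> v\<close> lies outside \<open>U\<close>, the edge from \<open>v\<close>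
  to \<open>\<pi> v\<close> meets \<open>U\<close> in \<open>v\<close> only. Each vertex of
  \<open>U\<close> thus owns one edge that no other vertex of \<open>U\<close> sees, and all
  residues can be set independently.\<close>

lemma prescribed_residues:
  fixes s r :: "'a \<Rightarrow> int" and h :: nat
  assumes sg: "simple_graph S F" and "0 < h"
    and \<pi>: "\<And>v. v \<in> U \<Longrightarrow> \<pi> v \<in> neighbours F v \<and> \<pi> v \<notin> U"
    and r: "\<And>v. v \<in> U \<Longrightarrow> 0 \<le> r v \<and> r v < h"
  shows "\<exists>y :: 'a set \<Rightarrow> int. (\<forall>e. 0 \<le> y e \<and> y e < h) \<and> (\<forall>e. y e \<noteq> 0 \<longrightarrow> (\<exists>v\<in>U. e = {\<pi> v, v})) \<and>
    (\<forall>v\<in>U. (s v + (\<Sum>u\<in>neighbours F v. y {u, v})) mod h = r v)"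
proof -
  note sgD = simple_graphD[OF sg]
  define y where "y e = (if \<exists>v\<in>U. e = {\<pi> v, v}
    then (r (the_elem (e \<inter> U)) - s (the_elem (e \<inter> U))) mod int h else 0)" for e
  have yv: "y {u, v} = (if u = \<pi> v then (r v - s v) mod h else 0)" if "v \<in> U" for u v
  proof -
    have "(\<exists>v'\<in>U. {u, v} = {\<pi> v', v'}) \<longleftrightarrow> u = \<pi> v"
      using that \<pi> by (auto simp: doubleton_eq_iff)
    moreover have "{\<pi> v, v} \<inter> U = {v}" using that \<pi> by auto
    ultimately show ?thesis by (auto simp: y_def)
  qed
  show ?thesis
  proof (intro exI[of _ y] conjI allI ballI impI)
    fix v assume v: "v \<in> U"
    have "(\<Sum>u\<in>neighbours F v. y {u, v}) = (r v - s v) mod h"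
      using yv[OF v] \<pi>[OF v] sgD(3) by (simp add: sum.delta)
    then have "(s v + (\<Sum>u\<in>neighbours F v. y {u, v})) mod h = r v mod h"
      by (simp add: mod_simps)
    then show "(s v + (\<Sum>u\<in>neighbours F v. y {u, v})) mod h = r v" using r[OF v] by simp
  qed (use \<open>0 < h\<close> in \<open>auto simp: y_def split: if_splits\<close>)
qed

text \<open>
  The vertices missed by a maximal matching are tuned through edges into the matching; every matching
  edge then moves only the residues of its two ends, and fewer than half of the shifts are
  bad for either end.
\<close>

lemma balanced_residues_no_isolated:
  fixes s :: "'a \<Rightarrow> int" and h T :: nat
  assumes sg: "simple_graph L F" and h: "0 < h" and T: "2 * card L < T * h"
    and iso: "\<And>v. v \<in> L \<Longrightarrow> neighbours F v \<noteq> {}"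
  shows "\<exists>y :: 'a set \<Rightarrow> int. (\<forall>e. 0 \<le> y e \<and> y e < h) \<and> (\<forall>e. e \<notin> F \<longrightarrow> y e = 0) \<and>
    (\<forall>\<rho>. card {v \<in> L. (s v + (\<Sum>u\<in>neighbours F v. y {u, v})) mod h = \<rho>} \<le> T + 1)"
proof -
  note sgD = simple_graphD[OF sg]
  have F: "e \<subseteq> L" "card e = 2" if "e \<in> F" for e using sg that by (auto simp: simple_graph_def)
  have finF: "finite F" using F(1) sgD(1) by (auto intro: finite_subset[of F "Pow L"])
  define matching where "matching = {M. M \<subseteq> F \<and> (\<forall>e\<in>M. \<forall>e'\<in>M. e \<noteq> e' \<longrightarrow> e \<inter> e' = {})}"
  have "matching \<subseteq> Pow F" unfolding matching_def by blast
  then have "finite matching" using finF by (simp add: finite_subset)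
  moreover have "{} \<in> matching" by (simp add: matching_def)
  ultimately obtain M where M: "M \<in> matching" "\<And>M'. M' \<in> matching \<Longrightarrow> M \<subseteq> M' \<Longrightarrow> M' = M"
    using finite_has_maximal[of matching] by (metis empty_iff)
  have MF: "M \<subseteq> F" and disj: "\<And>e e'. e \<in> M \<Longrightarrow> e' \<in> M \<Longrightarrow> e \<noteq> e' \<Longrightarrow> e \<inter> e' = {}"
    using M(1) by (auto simp: matching_def)
  define U where "U = L - \<Union>M"
  have finU: "finite U" using sgD(1) by (simp add: U_def)
  have "\<exists>u. u \<in> neighbours F v \<and> u \<notin> U" if v: "v \<in> U" for v
  proof (rule ccontr)
    \<comment> \<open>An edge inside \<open>U\<close> could be added to the maximal
      matching.\<close>
    assume no: "\<not> ?thesis"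
    obtain u where u: "u \<in> neighbours F v" using iso[of v] v by (auto simp: U_def)
    then have "u \<in> U" using no by blast
    then have "insert {u, v} M \<in> matching"
      using u v M(1) by (auto simp: matching_def neighbours_def U_def)
    then have "{u, v} \<in> M" using M(2) by blast
    then show False using v by (auto simp: U_def)
  qed
  then obtain \<pi> where \<pi>: "\<And>v. v \<in> U \<Longrightarrow> \<pi> v \<in> neighbours F v \<and> \<pi> v \<notin> U" by metis
  define res where "res y v = (s v + (\<Sum>u\<in>neighbours F v. y {u, v})) mod h" for y and v
  \<comment> \<open>The unit value serves as the only class.\<close>
  have "card {u \<in> U. () = j} \<le> T * h" for j
  proof -
    have "card {u \<in> U. () = j} \<le> card L" using sgD(1) by (intro card_mono) (auto simp: U_def)
    then show ?thesis using T by linarith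
  qed
  from balanced_assignment[OF finU this] obtain r :: "'a \<Rightarrow> int"
    where r: "\<And>v. v \<in> U \<Longrightarrow> 0 \<le> r v \<and> r v < h" "\<And>\<rho>. card {u \<in> U. r u = \<rho>} \<le> T" by auto
  obtain y0 :: "'a set \<Rightarrow> int" where y0: "\<forall>e. 0 \<le> y0 e \<and> y0 e < h"
    "\<forall>e. y0 e \<noteq> 0 \<longrightarrow> (\<exists>v\<in>U. e = {\<pi> v, v})" "\<forall>v\<in>U. res y0 v = r v"
    unfolding res_def using prescribed_residues[OF sg h, where U = U and \<pi> = \<pi> and r = r and s = s] \<pi> r(1) by blast
  \<comment> \<open>The induction adds one matching edge at a time and counts only the vertices
    covered so far. Matching edges not yet reached still carry 0, as \<open>y0\<close> lives on
    edges that meet \<open>U\<close>.\<close>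
  have "\<exists>y :: 'a set \<Rightarrow> int. (\<forall>e. 0 \<le> y e \<and> y e < h) \<and> (\<forall>e. e \<notin> F \<longrightarrow> y e = 0) \<and>
    (\<forall>e\<in>M - M'. y e = 0) \<and> (\<forall>\<rho>. card {v \<in> U \<union> \<Union>M'. res y v = \<rho>} \<le> T + 1)"
    if "M' \<subseteq> M" for M'
  proof -
    have "finite M'" using that MF finF by (meson finite_subset)
    then show ?thesis using that
    proof (induction M' rule: finite_induct)
      case empty
      show ?case
      proof (intro exI[of _ y0] conjI allI impI ballI)
        fix e assume "e \<notin> F"
        then show "y0 e = 0" using y0(2) \<pi> by (force simp: neighbours_def)
      next
        fix e assume "e \<in> M - {}"
        then show "y0 e = 0" using y0(2) by (force simp: U_def)
      next
        fix \<rho>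
        have "{v \<in> U \<union> \<Union>{}. res y0 v = \<rho>} = {v \<in> U. r v = \<rho>}" using y0(3) by auto
        then show "card {v \<in> U \<union> \<Union>{}. res y0 v = \<rho>} \<le> T + 1" using r(2)[of \<rho>] by simp
      qed (use y0(1) in auto)
    next
      case (insert e M')
      define P where "P = U \<union> \<Union>M'"
      have "M' \<subseteq> M" using insert by auto
      from insert.IH[OF this, folded P_def] obtain y :: "'a set \<Rightarrow> int" where
        yE: "\<forall>e. 0 \<le> y e \<and> y e < h" "\<forall>e. e \<notin> F \<longrightarrow> y e = 0"
        "\<forall>e\<in>M - M'. y e = 0" "\<forall>\<rho>. card {v \<in> P. res y v = \<rho>} \<le> T + 1"
        by (elim exE conjE) (rule that)
      note y = yE[rule_format]
      have eM: "e \<in> M" "e \<in> F" using insert MF by auto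
      obtain a b where ab: "e = {a, b}" "a \<noteq> b" using F(2)[OF eM(2)] by (meson card_2_iff)
      have "e \<inter> e' = {}" if "e' \<in> M'" for e'
        using that insert by (intro disj) auto
      moreover have "e \<inter> U = {}" using eM(1) by (auto simp: U_def)
      ultimately have "e \<inter> P = {}" by (auto simp: P_def)
      have "P \<subseteq> L" using F(1) insert.prems MF by (auto simp: P_def U_def)
      then have finP: "finite P" and cardP: "card P \<le> card L"
        using sgD(1) by (auto intro: finite_subset card_mono)
      \<comment> \<open>The shifts that would move \<open>z\<close> to a residue already taken by
        \<open>T\<close> vertices of \<open>P\<close>. They number fewer than \<open>h / 2\<close>
        because \<open>2 * card L < T * h\<close>, so the shifts bad for \<open>a\<close> and those
        bad for \<open>b\<close> do not exhaust the residues.\<close>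
      define Bad where "Bad z = {\<rho> \<in> {0..<int h}. T \<le> card {u \<in> P. (res y u - res y z) mod h = \<rho>}}" for z
      have finBad: "finite (Bad z)" for z unfolding Bad_def
        by (rule finite_subset[of _ "{0..<int h}"]) auto
      have cardBad: "2 * card (Bad z) < h" for z
      proof -
        have "T * card (Bad z) \<le> card P" unfolding Bad_def by (rule heavy_fibres) (use finP in auto)
        then have "T * (2 * card (Bad z)) < T * h" using T cardP by linarith
        then show ?thesis by simp
      qed
      have "card (Bad a \<union> Bad b) < card {0..<int h}"
        using card_Un_le[of "Bad a" "Bad b"] cardBad[of a] cardBad[of b] by simp
      then have "\<not> {0..<int h} \<subseteq> Bad a \<union> Bad b"
        using card_mono[of "Bad a \<union> Bad b" "{0..<int h}"] finBad by auto
      then obtain \<rho> where "\<rho> \<in> {0..<int h}" "\<rho> \<notin> Bad a" "\<rho> \<notin> Bad b" by blast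
      then have \<rho>: "0 \<le> \<rho>" "\<rho> < h" "\<rho> \<notin> Bad a" "\<rho> \<notin> Bad b" by auto
      define y' where "y' = y(e := \<rho>)"
      have unchanged: "res y' v = res y v" if "v \<notin> e" for v
      proof -
        have "(\<Sum>u\<in>neighbours F v. y' {u, v}) = (\<Sum>u\<in>neighbours F v. y {u, v})"
          using that by (intro sum.cong) (auto simp: y'_def)
        then show ?thesis by (simp add: res_def)
      qed
      have shifted: "res y' v = (res y v + \<rho>) mod h" if v: "v \<in> e" for v
      proof -
        obtain u where u: "e = {u, v}" "u \<noteq> v" using v ab by auto
        have "(\<Sum>w\<in>neighbours F v. y' {w, v}) = (\<Sum>w\<in>neighbours F v. y {w, v} + (if w = u then \<rho> else 0))"
          using u y(3)[of e] eM insert by (intro sum.cong) (auto simp: y'_def doubleton_eq_iff)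
        also have "\<dots> = (\<Sum>w\<in>neighbours F v. y {w, v}) + \<rho>"
          using u eM sgD(3) by (auto simp: sum.distrib sum.delta neighbours_def)
        finally show ?thesis by (simp add: res_def mod_simps add.assoc)
      qed
      have light: "card {u \<in> P. res y u = res y' z} < T" if z: "z \<in> e" for z
      proof -
        have "\<rho> \<notin> Bad z" using z ab \<rho> by auto
        then have "card {u \<in> P. (res y u - res y z) mod h = \<rho>} < T" using \<rho> by (simp add: Bad_def not_le)
        moreover have "(res y u - res y z) mod h = \<rho> \<longleftrightarrow> res y u = res y' z" for u
        proof -
          have "0 \<le> res y u" "res y u < h" using h by (auto simp: res_def)
          then have "res y u mod h = res y u" by simp
          moreover have "\<rho> mod h = \<rho>" using \<rho> by simp
          ultimately show ?thesis unfolding shifted[OF z]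
            by (metis add.commute add_diff_cancel_left' diff_add_cancel mod_add_left_eq mod_diff_left_eq)
        qed
        ultimately show ?thesis by simp
      qed
      have P': "U \<union> \<Union>(insert e M') = P \<union> e" by (auto simp: P_def)
      have "card {v \<in> P \<union> e. res y' v = \<rho>'} \<le> T + 1" for \<rho>'
      proof -
        have eq: "{v \<in> P \<union> e. res y' v = \<rho>'} = {v \<in> P. res y v = \<rho>'} \<union> {v \<in> e. res y' v = \<rho>'}"
          using unchanged \<open>e \<inter> P = {}\<close> by auto
        show ?thesis
        proof (cases "\<exists>z\<in>e. res y' z = \<rho>'")
          case True
          \<comment> \<open>Both ends of the edge may land on the same residue, so fewer than
            \<open>T\<close> vertices can become \<open>T + 1\<close>: the origin of the extra
            1.\<close>
          then have "card {v \<in> P. res y v = \<rho>'} < T" using light by auto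
          moreover have "card {v \<in> e. res y' v = \<rho>'} \<le> card e" using ab by (intro card_mono) auto
          ultimately show ?thesis
            using F(2)[OF eM(2)] card_Un_le[of "{v \<in> P. res y v = \<rho>'}" "{v \<in> e. res y' v = \<rho>'}"]
            unfolding eq by linarith
        next
          case False
          then have none: "{v \<in> e. res y' v = \<rho>'} = {}" by auto
          show ?thesis unfolding eq none using y(4)[of \<rho>'] by simp
        qed
      qed
      moreover have "\<forall>e. 0 \<le> y' e \<and> y' e < h" "\<forall>e. e \<notin> F \<longrightarrow> y' e = 0"
        "\<forall>e\<in>M - insert e M'. y' e = 0"
        using y \<rho> eM by (auto simp: y'_def)
      ultimately show ?case unfolding P' by blast
    qed
  qed
  from this[of M] obtain y :: "'a set \<Rightarrow> int" where y: "\<forall>e. 0 \<le> y e \<and> y e < h" "\<forall>e. e \<notin> F \<longrightarrow> y e = 0"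
    "\<forall>\<rho>. card {v \<in> U \<union> \<Union>M. res y v = \<rho>} \<le> T + 1" by auto
  have "U \<union> \<Union>M = L" using F(1) MF by (auto simp: U_def)
  then show ?thesis using y by (auto simp: res_def)
qed

text \<open>Vertices outside class 0 are tuned by private edges into class 0. Class 0 is balanced
  afterwards by edges inside it, which leave all other residues alone; its vertices have neighbours
  there, so no vertex is isolated.\<close>

lemma balanced_residues:
  fixes s :: "'a \<Rightarrow> int" and h T :: nat and cls :: "'a \<Rightarrow> nat"
  assumes sg: "simple_graph S F" and h: "0 < h"
    and L: "2 * card {v \<in> S. cls v = 0} < T * h" and big: "\<And>j. card {v \<in> S. cls v = j} \<le> T * h"
    and nb: "\<And>v. v \<in> S \<Longrightarrow> \<exists>u\<in>neighbours F v. cls u = 0"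
  shows "\<exists>y :: 'a set \<Rightarrow> int. (\<forall>e. 0 \<le> y e \<and> y e < h) \<and>
    (\<forall>j \<rho>. card {v \<in> S. cls v = j \<and> (s v + (\<Sum>u\<in>neighbours F v. y {u, v})) mod h = \<rho>} \<le> T + 1)"
proof -
  note sgD = simple_graphD[OF sg]
  define L where "L = {v \<in> S. cls v = 0}"
  define U where "U = S - L"
  have finU: "finite U" using sgD(1) by (simp add: U_def)
  obtain \<pi> where \<pi>': "\<And>v. v \<in> S \<Longrightarrow> \<pi> v \<in> neighbours F v \<and> cls (\<pi> v) = 0"
    using nb by metis
  have \<pi>: "\<pi> v \<in> neighbours F v \<and> \<pi> v \<notin> U" if "v \<in> U" for v
    using \<pi>'[of v] that sgD(2)[of v] by (auto simp: U_def L_def)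
  have "card {u \<in> U. cls u = j} \<le> T * h" for j
    using sgD(1) by (intro order_trans[OF card_mono big[of j]]) (auto simp: U_def)
  from balanced_assignment[OF finU this] obtain r :: "'a \<Rightarrow> int" where
    r: "\<And>v. v \<in> U \<Longrightarrow> 0 \<le> r v \<and> r v < h" "\<And>j \<rho>. card {u \<in> U. cls u = j \<and> r u = \<rho>} \<le> T"
    by auto
  obtain y1 :: "'a set \<Rightarrow> int" where y1: "\<forall>e. 0 \<le> y1 e \<and> y1 e < h"
    "\<forall>e. y1 e \<noteq> 0 \<longrightarrow> (\<exists>v\<in>U. e = {\<pi> v, v})"
    "\<forall>v\<in>U. (s v + (\<Sum>u\<in>neighbours F v. y1 {u, v})) mod h = r v"
    using prescribed_residues[OF sg h, where U = U and \<pi> = \<pi> and r = r and s = s] \<pi> r(1) by blast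
  define s' where "s' v = s v + (\<Sum>u\<in>neighbours F v. y1 {u, v})" for v
  define FL where "FL = {e \<in> F. e \<subseteq> L}"
  have sgL: "simple_graph L FL"
    using sg sgD(1) by (auto simp: simple_graph_def FL_def L_def)
  have nbL: "neighbours FL v = neighbours F v \<inter> L" if "v \<in> L" for v
    using that by (auto simp: neighbours_def FL_def)
  have "neighbours FL v \<noteq> {}" if v: "v \<in> L" for v
  proof -
    have "v \<in> S" using v by (simp add: L_def)
    then have "\<pi> v \<in> neighbours F v" "cls (\<pi> v) = 0" using \<pi>' by auto
    then have "\<pi> v \<in> neighbours FL v" using nbL[OF v] sgD(2)[of v] by (auto simp: L_def)
    then show ?thesis by auto
  qed
  from balanced_residues_no_isolated[OF sgL h _ this, of T s'] obtain y2 :: "'a set \<Rightarrow> int" where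
    y2: "\<And>e. 0 \<le> y2 e \<and> y2 e < h" "\<And>e. e \<notin> FL \<Longrightarrow> y2 e = 0"
    "\<And>\<rho>. card {v \<in> L. (s' v + (\<Sum>u\<in>neighbours FL v. y2 {u, v})) mod h = \<rho>} \<le> T + 1"
    using L by (auto simp: L_def)
  define y where "y e = (if e \<in> FL then y2 e else y1 e)" for e
  have y_add: "y e = y1 e + y2 e" for e
  proof -
    have "y1 e = 0" if "e \<in> FL"
      using that y1(2) by (auto simp: FL_def U_def)
    then show ?thesis using y2(2) by (auto simp: y_def)
  qed
  have sum_y: "s v + (\<Sum>u\<in>neighbours F v. y {u, v}) = s' v + (\<Sum>u\<in>neighbours F v. y2 {u, v})" for v
    by (simp add: y_add sum.distrib s'_def)
  have resU: "(s v + (\<Sum>u\<in>neighbours F v. y {u, v})) mod h = r v" if "v \<in> U" for v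
  proof -
    have "(\<Sum>u\<in>neighbours F v. y2 {u, v}) = 0"
      using that by (intro sum.neutral ballI y2(2)) (auto simp: FL_def U_def)
    then show ?thesis using y1(3) that by (simp add: sum_y s'_def)
  qed
  have resL: "s v + (\<Sum>u\<in>neighbours F v. y {u, v}) = s' v + (\<Sum>u\<in>neighbours FL v. y2 {u, v})" if "v \<in> L" for v
  proof -
    have "(\<Sum>u\<in>neighbours F v. y2 {u, v}) = (\<Sum>u\<in>neighbours FL v. y2 {u, v})"
      unfolding nbL[OF that] using that sgD(3)
      by (intro sum.mono_neutral_right) (auto intro!: y2(2) simp: FL_def)
    then show ?thesis by (simp add: sum_y)
  qed
  show ?thesis
  proof (intro exI[of _ y] conjI allI)
    show "0 \<le> y e" "y e < h" for e using y1(1) y2(1) by (auto simp: y_def)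
    fix j \<rho>
    show "card {v \<in> S. cls v = j \<and> (s v + (\<Sum>u\<in>neighbours F v. y {u, v})) mod h = \<rho>} \<le> T + 1"
    proof (cases "j = 0")
      case True
      then have "{v \<in> S. cls v = j \<and> (s v + (\<Sum>u\<in>neighbours F v. y {u, v})) mod h = \<rho>}
        = {v \<in> L. (s' v + (\<Sum>u\<in>neighbours FL v. y2 {u, v})) mod h = \<rho>}"
        using resL by (auto simp: L_def)
      then show ?thesis using y2(3) by simp
    next
      case False
      then have "{v \<in> S. cls v = j \<and> (s v + (\<Sum>u\<in>neighbours F v. y {u, v})) mod h = \<rho>}
        = {v \<in> U. cls v = j \<and> r v = \<rho>}"
        using resU by (auto simp: L_def U_def)
      then show ?thesis using r(2)[of j \<rho>] by simp
    qed
  qed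
qed

section \<open>The weighting\<close>

lemma bounded_distribution:
  fixes D A :: nat
  assumes "finite N" "D \<le> A * card N"
  shows "\<exists>p. (\<forall>u\<in>N. p u \<le> A) \<and> (\<Sum>u\<in>N. p u) = D"
  using assms
proof (induction N arbitrary: D rule: finite_induct)
  case empty
  then show ?case by simp
next
  case (insert a N)
  have "D - min A D \<le> A * card N" using insert.prems insert.hyps by auto
  then obtain p where p: "\<forall>u\<in>N. p u \<le> A" "(\<Sum>u\<in>N. p u) = D - min A D" using insert.IH by blast
  have "(\<Sum>u\<in>N. (p(a := min A D)) u) = (\<Sum>u\<in>N. p u)"
    using insert.hyps by (intro sum.cong) auto
  then have "(\<Sum>u\<in>insert a N. (p(a := min A D)) u) = min A D + (\<Sum>u\<in>N. p u)"
    using insert.hyps by simp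
  then show ?case using p by (intro exI[of _ "p(a := min A D)"]) auto
qed

lemma monotone_threshold:
  fixes f :: "nat \<Rightarrow> nat"
  assumes "\<And>q q'. q \<le> q' \<Longrightarrow> q' < K \<Longrightarrow> f q \<le> f q'"
  shows "\<exists>t\<le>K. \<forall>q<K. i < f q \<longleftrightarrow> t \<le> q"
proof -
  define t where "t = (LEAST q. K \<le> q \<or> i < f q)"
  have tK: "t \<le> K" unfolding t_def by (rule Least_le) simp
  have t: "K \<le> t \<or> i < f t" unfolding t_def by (rule LeastI[of _ K]) simp
  have "i < f q \<longleftrightarrow> t \<le> q" if "q < K" for q
  proof
    assume "i < f q" then show "t \<le> q" unfolding t_def by (intro Least_le) simp
  next
    assume "t \<le> q" then show "i < f q" using t that assms[of t q] by auto
  qed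
  then show ?thesis using tK by blast
qed

text \<open>Layer-cake decomposition: a monotone \<open>f\<close> with values up to \<open>M\<close>
  is a sum of \<open>M\<close> indicators of final segments of colours, and each of them contributes
  an error of at most \<open>l\<close>. This is why control of initial segments suffices.\<close>

lemma sum_monotone_equidistributed:
  fixes f c :: "_ \<Rightarrow> nat" and K M :: nat and l :: real
  assumes fin: "finite N" and c: "\<And>u. u \<in> N \<Longrightarrow> c u < K" and K: "0 < K"
    and dev: "\<And>t. t \<le> K \<Longrightarrow> \<bar>real (card {u \<in> N. c u < t}) - card N * (t / K)\<bar> \<le> l"
    and mono: "\<And>q q'. q \<le> q' \<Longrightarrow> q' < K \<Longrightarrow> f q \<le> f q'" and M: "\<And>q. q < K \<Longrightarrow> f q \<le> M"
  shows "\<bar>real (\<Sum>u\<in>N. f (c u)) - card N / K * real (\<Sum>q<K. f q)\<bar> \<le> M * l"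
proof -
  obtain t where t: "\<And>i. t i \<le> K" "\<And>i q. q < K \<Longrightarrow> i < f q \<longleftrightarrow> t i \<le> q"
  proof -
    have "\<exists>t\<le>K. \<forall>q<K. i < f q \<longleftrightarrow> t \<le> q" for i
      by (rule monotone_threshold) (rule mono)
    then show thesis using that by metis
  qed
  have layers: "real (f q) = (\<Sum>i<M. of_bool (t i \<le> q))" if "q < K" for q
  proof -
    have "{..<M} \<inter> {i. t i \<le> q} = {..<f q}"
      unfolding t(2)[OF that, symmetric] using M[OF that] by auto
    then show ?thesis by simp
  qed
  have "real (\<Sum>u\<in>N. f (c u)) = (\<Sum>u\<in>N. \<Sum>i<M. of_bool (t i \<le> c u))"
    using layers c by simp
  also have "\<dots> = (\<Sum>i<M. \<Sum>u\<in>N. of_bool (t i \<le> c u))" by (rule sum.swap)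
  also have "\<dots> = (\<Sum>i<M. card N - real (card {u \<in> N. c u < t i}))"
  proof (rule sum.cong)
    fix i
    have "(\<Sum>u\<in>N. of_bool (t i \<le> c u)) = (\<Sum>u\<in>N. 1 - of_bool (c u < t i) :: real)"
      by (intro sum.cong) auto
    also have "\<dots> = card N - real (card {u \<in> N. c u < t i})"
      using fin by (simp add: sum_subtractf Int_def)
    finally show "(\<Sum>u\<in>N. of_bool (t i \<le> c u)) = card N - real (card {u \<in> N. c u < t i})" .
  qed simp
  finally have 1: "real (\<Sum>u\<in>N. f (c u)) = (\<Sum>i<M. card N - real (card {u \<in> N. c u < t i}))" .
  have "real (\<Sum>q<K. f q) = (\<Sum>q<K. \<Sum>i<M. of_bool (t i \<le> q))" using layers by simp
  also have "\<dots> = (\<Sum>i<M. \<Sum>q<K. of_bool (t i \<le> q))" by (rule sum.swap)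
  also have "\<dots> = (\<Sum>i<M. real K - t i)"
  proof (rule sum.cong)
    fix i
    have "{..<K} \<inter> {q. t i \<le> q} = {t i..<K}" by auto
    then show "(\<Sum>q<K. of_bool (t i \<le> q)) = real K - t i" using t(1)[of i] by (simp add: of_nat_diff)
  qed simp
  finally have "card N / K * real (\<Sum>q<K. f q) = (\<Sum>i<M. card N / K * (real K - t i))"
    by (simp add: sum_distrib_left)
  also have "\<dots> = (\<Sum>i<M. card N - card N * (t i / K))"
    using K by (intro sum.cong) (auto simp: field_simps)
  finally have 2: "card N / K * real (\<Sum>q<K. f q) = (\<Sum>i<M. card N - card N * (t i / K))" .
  have "\<bar>real (\<Sum>u\<in>N. f (c u)) - card N / K * real (\<Sum>q<K. f q)\<bar>
    = \<bar>\<Sum>i<M. (card N - real (card {u \<in> N. c u < t i})) - (card N - card N * (t i / K))\<bar>"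
    unfolding 1 2 by (simp only: sum_subtractf)
  also have "\<dots> \<le> (\<Sum>i<M. \<bar>(card N - real (card {u \<in> N. c u < t i})) - (card N - card N * (t i / K))\<bar>)"
    by (rule sum_abs)
  also have "\<dots> \<le> (\<Sum>i<M. l)"
  proof (rule sum_mono)
    fix i
    show "\<bar>(card N - real (card {u \<in> N. c u < t i})) - (card N - card N * (t i / K))\<bar> \<le> l"
      using dev[OF t(1), of i] by (simp add: abs_minus_commute)
  qed
  finally show ?thesis by simp
qed

text \<open>The rank counts predecessors in the order by colour, with ties broken by an arbitrary
  numbering.\<close>

lemma rank_by_colour:
  fixes c :: "'a \<Rightarrow> nat"
  assumes "finite V"
  shows "\<exists>rk :: 'a \<Rightarrow> nat. inj_on rk V \<and>
    (\<forall>v\<in>V. card {u \<in> V. c u < c v} \<le> rk v \<and> rk v < card {u \<in> V. c u < c v + 1})"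
proof -
  obtain num :: "'a \<Rightarrow> nat" where num: "inj_on num V"
    using finite_imp_inj_to_nat_seg[OF assms] by blast
  define before where "before v = {u \<in> V. c u < c v \<or> (c u = c v \<and> num u < num v)}" for v
  have fin: "finite (before v)" for v using assms by (simp add: before_def)
  have less: "card (before u) < card (before v)" if "u \<in> before v" for u v
  proof (rule psubset_card_mono[OF fin])
    show "before u \<subset> before v" using that by (auto simp: before_def)
  qed
  show ?thesis
  proof (intro exI[of _ "\<lambda>v. card (before v)"] conjI ballI inj_onI)
    fix u v assume uv: "u \<in> V" "v \<in> V" "card (before u) = card (before v)"
    show "u = v"
    proof (rule ccontr)
      assume "u \<noteq> v"
      then have "num u \<noteq> num v" using num uv by (auto dest: inj_onD)
      then have "u \<in> before v \<or> v \<in> before u" using uv by (auto simp: before_def)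
      then show False using less uv by fastforce
    qed
  next
    fix v assume v: "v \<in> V"
    show "card {u \<in> V. c u < c v} \<le> card (before v)"
      by (rule card_mono[OF fin]) (auto simp: before_def)
    show "card (before v) < card {u \<in> V. c u < c v + 1}"
      using assms v by (intro psubset_card_mono) (auto simp: before_def)
  qed
qed

text \<open>Double counting: by regularity every \<open>u\<close> with \<open>c u < t\<close> is
  counted in exactly \<open>d\<close> neighbourhoods, so the local deviations average to a global
  one.\<close>

lemma global_count:
  fixes c :: "'a \<Rightarrow> nat" and d :: nat and l p :: real
  assumes reg: "regular_graph d V E" and d: "0 < d"
    and dev: "\<And>v. v \<in> V \<Longrightarrow> \<bar>real (card {u \<in> neighbours E v. c u < t}) - d * p\<bar> \<le> l"
  shows "\<bar>real (card {u \<in> V. c u < t}) - card V * p\<bar> \<le> l * (card V / d)"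
proof -
  have sg: "simple_graph V E" and deg: "\<And>v. v \<in> V \<Longrightarrow> card (neighbours E v) = d"
    using reg by (auto simp: regular_graph_def)
  note sgD = simple_graphD[OF sg]
  have "(\<Sum>v\<in>V. card {u \<in> neighbours E v. c u < t})
    = (\<Sum>v\<in>V. \<Sum>u\<in>{u \<in> {u \<in> V. c u < t}. u \<in> neighbours E v}. 1)"
  proof (rule sum.cong)
    fix v
    have "{u \<in> neighbours E v. c u < t} = {u \<in> {u \<in> V. c u < t}. u \<in> neighbours E v}"
      using sgD(2)[of v] by auto
    then show "card {u \<in> neighbours E v. c u < t} = (\<Sum>u\<in>{u \<in> {u \<in> V. c u < t}. u \<in> neighbours E v}. 1)"
      by (simp only: card_eq_sum)
  qed simp
  also have "\<dots> = (\<Sum>u\<in>{u \<in> V. c u < t}. \<Sum>v\<in>{v \<in> V. u \<in> neighbours E v}. 1)"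
    using sgD(1) by (intro sum.swap_restrict) auto
  also have "\<dots> = (\<Sum>u\<in>{u \<in> V. c u < t}. d)"
  proof (rule sum.cong)
    fix u assume "u \<in> {u \<in> V. c u < t}"
    moreover have "{v \<in> V. u \<in> neighbours E v} = neighbours E u"
      using sgD(2)[of u] sgD(5) by blast
    ultimately show "(\<Sum>v\<in>{v \<in> V. u \<in> neighbours E v}. 1) = d" using deg by simp
  qed simp
  finally have "(\<Sum>v\<in>V. card {u \<in> neighbours E v. c u < t}) = card {u \<in> V. c u < t} * d" by simp
  then have "real (\<Sum>v\<in>V. card {u \<in> neighbours E v. c u < t}) = real (card {u \<in> V. c u < t} * d)"
    by (rule arg_cong)
  then have "\<bar>card {u \<in> V. c u < t} * real d - card V * (d * p)\<bar>
    = \<bar>\<Sum>v\<in>V. real (card {u \<in> neighbours E v. c u < t}) - d * p\<bar>"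
    by (simp add: sum_subtractf)
  also have "\<dots> \<le> (\<Sum>v\<in>V. \<bar>real (card {u \<in> neighbours E v. c u < t}) - d * p\<bar>)" by (rule sum_abs)
  also have "\<dots> \<le> (\<Sum>v\<in>V. l)" using dev by (intro sum_mono) auto
  finally have "\<bar>(card {u \<in> V. c u < t} - card V * p) * d\<bar> \<le> card V * l" by (simp add: algebra_simps)
  then have "\<bar>card {u \<in> V. c u < t} - card V * p\<bar> * d \<le> card V * l" by (simp add: abs_mult)
  then show ?thesis using d by (simp add: field_simps)
qed

text \<open>
  The \<open>K = K' * g\<close> colours form \<open>K'\<close> strips of width \<open>g\<close>; the colours from \<open>W\<close> on are the 17 strips of \<open>S\<close>.
  The lowest of them is class 0, every later class consists of two strips: class 0 has to be smaller by a
  factor of two because of the loss in \<open>balanced_residues_no_isolated\<close>.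
\<close>

locale strip_weighting =
  fixes V :: "'a set" and E :: "'a set set" and d K' g H h A r T :: nat
    and c :: "'a \<Rightarrow> nat" and l :: real
  fixes k K W :: nat
  defines "k \<equiv> H + 1 + 9 * A + 9 * r" and "K \<equiv> K' * g" and "W \<equiv> (K' - 17) * g"
  assumes reg: "regular_graph d V E" and d_pos: "0 < d" and g_pos: "0 < g" and K'_ge: "18 \<le> K'"
    and c_less: "v \<in> V \<Longrightarrow> c v < K"
    and dev: "v \<in> V \<Longrightarrow> t \<le> K \<Longrightarrow>
      \<bar>real (card {u \<in> neighbours E v. c u < t}) - real d * (real t / real K)\<bar> \<le> l"
    and H_ge: "card V \<le> H * d"
    and A_ge: "5 * real k * l + 2 \<le> real A * (17 * real d / real K' - l)"
    and r_ge: "34 * real d * real k / real K' + 3 * real k * l + 2 < real r * real d"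
    and T_h: "2 * real (card V) / real K' + 4 * l * (real (card V) / real d) < real T * real h"
    and T_le: "2 * (real T + 1) \<le> 17 * real d / real K' - l"
    and l_less: "2 * l < real d / real K'"
    and h_le: "4 * h \<le> k" and h_pos: "0 < h"
    and g_ge: "real d / real K \<le> l"
begin

abbreviation "N \<equiv> neighbours E"

lemma sg: "simple_graph V E" and deg: "v \<in> V \<Longrightarrow> card (N v) = d"
  using reg by (auto simp: regular_graph_def)

lemmas sgD = simple_graphD[OF sg]

lemma K_pos: "0 < K" and W_le: "W \<le> K" and W_eq: "W + 17 * g = K"
proof -
  show "0 < K" using g_pos K'_ge by (simp add: K_def)
  have "W + 17 * g = (K' - 17 + 17) * g" by (simp add: W_def algebra_simps)
  then show "W + 17 * g = K" using K'_ge by (simp add: K_def)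
  then show "W \<le> K" by simp
qed

lemma strip_ratio: "real (a * g) / real K = real a / real K'"
  using g_pos by (simp add: K_def)

lemma l_pos: "0 < l"
  using g_ge d_pos K_pos by (smt (verit) divide_pos_pos of_nat_0_less_iff)

section \<open>Strips, classes, and their sizes in neighbourhoods and in the whole graph\<close>

definition B :: "'a set" where "B = {v \<in> V. c v < W}"
definition S :: "'a set" where "S = {v \<in> V. W \<le> c v}"

lemma B_S: "B \<subseteq> V" "S \<subseteq> V" "B \<inter> S = {}" "B \<union> S = V" "finite B" "finite S"
  using sgD(1) by (auto simp: B_def S_def)

lemma count_above:
  assumes "v \<in> V" "t \<le> K"
  shows "\<bar>real (card {u \<in> N v. t \<le> c u}) - real d * (1 - real t / real K)\<bar> \<le> l"
proof -
  have "card ({u \<in> N v. c u < t} \<union> {u \<in> N v. t \<le> c u}) = card {u \<in> N v. c u < t} + card {u \<in> N v. t \<le> c u}"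
    using sgD(3) by (intro card_Un_disjoint) auto
  moreover have "{u \<in> N v. c u < t} \<union> {u \<in> N v. t \<le> c u} = N v" by auto
  ultimately have "real d = real (card {u \<in> N v. c u < t}) + real (card {u \<in> N v. t \<le> c u})"
    using deg[OF assms(1)] by simp
  then show ?thesis using dev[OF assms] by (simp add: algebra_simps abs_le_iff)
qed

lemma card_between:
  assumes "finite M" "s \<le> t"
  shows "real (card {u \<in> M. s \<le> c u \<and> c u < t}) = real (card {u \<in> M. c u < t}) - real (card {u \<in> M. c u < s})"
proof -
  have "card ({u \<in> M. c u < s} \<union> {u \<in> M. s \<le> c u \<and> c u < t})
    = card {u \<in> M. c u < s} + card {u \<in> M. s \<le> c u \<and> c u < t}"
    using assms by (intro card_Un_disjoint) auto
  moreover have "{u \<in> M. c u < s} \<union> {u \<in> M. s \<le> c u \<and> c u < t} = {u \<in> M. c u < t}"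
    using assms by auto
  ultimately show ?thesis by simp
qed

lemma global_dev:
  assumes "t \<le> K"
  shows "\<bar>real (card {u \<in> V. c u < t}) - real (card V) * (real t / real K)\<bar> \<le> l * (real (card V) / real d)"
  by (rule global_count[OF reg d_pos dev]) (use assms in auto)

lemma global_strip:
  assumes "s + a * g = t" "t \<le> K"
  shows "real (card {u \<in> V. s \<le> c u \<and> c u < t}) \<le> real a * (real (card V) / real K') + 2 * l * (real (card V) / real d)"
proof -
  have "real t / real K - real s / real K = real (a * g) / real K"
    using assms(1) by (auto simp: diff_divide_distrib[symmetric])
  then have "real (card V) * (real t / real K) - real (card V) * (real s / real K) = real a * (real (card V) / real K')"
    unfolding strip_ratio by (simp only: right_diff_distrib[symmetric]) simp
  moreover have "real (card {u \<in> V. s \<le> c u \<and> c u < t}) = real (card {u \<in> V. c u < t}) - real (card {u \<in> V. c u < s})"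
    using assms sgD(1) by (intro card_between) auto
  ultimately show ?thesis using global_dev[of t] global_dev[of s] assms by (simp add: abs_le_iff)
qed

lemma S_degree:
  assumes "v \<in> V"
  shows "\<bar>real (card (N v \<inter> S)) - 17 * real d / real K'\<bar> \<le> l"
proof -
  have "N v \<inter> S = {u \<in> N v. W \<le> c u}" using sgD(2)[of v] by (auto simp: S_def)
  moreover have "1 - real W / real K = 17 / real K'"
  proof -
    have "1 - real W / real K = (real K - real W) / real K" using K_pos by (simp add: diff_divide_distrib)
    also have "real K - real W = real (17 * g)" using W_eq by simp
    finally show ?thesis using strip_ratio[of 17] by simp
  qed
  ultimately show ?thesis using count_above[OF assms W_le] by (simp add: mult.commute)
qed

text \<open>Strip 0 above \<open>W\<close> gets class 0, and strips \<open>2 * j + 1\<close> and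
  \<open>2 * j + 2\<close> get class \<open>j + 1\<close>. Below \<open>W\<close> the truncated
  subtraction gives class 0, so \<open>cl\<close> is monotone on all colours.\<close>

definition cl :: "nat \<Rightarrow> nat" where "cl q = ((q - W) div g + 1) div 2"

lemma cl_mono: "q \<le> q' \<Longrightarrow> cl q \<le> cl q'"
  unfolding cl_def by (intro div_le_mono add_right_mono diff_le_mono)

lemma cl_le: "q < K \<Longrightarrow> cl q \<le> 8"
proof -
  assume "q < K"
  then have "q - W < 17 * g" using W_eq g_pos by linarith
  then have "(q - W) div g < 17" by (simp add: less_mult_imp_div_less)
  then show ?thesis by (simp add: cl_def)
qed

lemma cl_eq_0: "W \<le> q \<Longrightarrow> cl q = 0 \<longleftrightarrow> q < W + g"
proof -
  assume "W \<le> q"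
  have "cl q = 0 \<longleftrightarrow> (q - W) div g = 0" by (auto simp: cl_def div_eq_0_iff)
  also have "\<dots> \<longleftrightarrow> q - W < g" using g_pos by (simp add: div_eq_0_iff)
  finally show ?thesis using \<open>W \<le> q\<close> by auto
qed

lemma cl_eq_SucD:
  assumes "W \<le> q" "cl q = Suc j"
  shows "W + (2 * j + 1) * g \<le> q" "q < W + (2 * j + 3) * g"
proof -
  define i where "i = (q - W) div g"
  have i: "2 * j + 1 \<le> i" "i \<le> 2 * j + 2" using assms(2) by (auto simp: cl_def i_def)
  have "i * g \<le> q - W" by (simp add: i_def)
  moreover have "(2 * j + 1) * g \<le> i * g" using i by (intro mult_right_mono) auto
  ultimately show "W + (2 * j + 1) * g \<le> q" using assms(1) by linarith
  have "q - W < (i + 1) * g" using g_pos unfolding i_def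
    by (metis Suc_eq_plus1 dividend_less_div_times mult.commute mult_Suc add.commute)
  moreover have "(i + 1) * g \<le> (2 * j + 3) * g" using i by (intro mult_right_mono) auto
  ultimately show "q < W + (2 * j + 3) * g" using assms(1) by linarith
qed

text \<open>\<open>T_h\<close> is twice the bound for a single strip. The same number bounds the two
  strips of a later class.\<close>

lemma card_class_0: "2 * card {v \<in> S. cl (c v) = 0} < T * h"
proof -
  have "{v \<in> S. cl (c v) = 0} = {u \<in> V. W \<le> c u \<and> c u < W + g}" using cl_eq_0 by (auto simp: S_def)
  then have "real (card {v \<in> S. cl (c v) = 0}) \<le> real (card V) / real K' + 2 * l * (real (card V) / real d)"
    using global_strip[of W 1 "W + g"] W_eq by simp
  then have "real (2 * card {v \<in> S. cl (c v) = 0}) < real (T * h)" using T_h by simp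
  then show ?thesis by (simp only: of_nat_less_iff)
qed

lemma card_class: "card {v \<in> S. cl (c v) = j} \<le> T * h"
proof (cases j)
  case 0
  then show ?thesis using card_class_0 by simp
next
  case (Suc i)
  show ?thesis
  proof (cases "j \<le> 8")
    case True
    have "(2 * i + 3) * g \<le> 17 * g" using True Suc by (intro mult_right_mono) auto
    then have "W + (2 * i + 3) * g \<le> K" using W_eq by linarith
    then have "real (card {u \<in> V. W + (2 * i + 1) * g \<le> c u \<and> c u < W + (2 * i + 3) * g})
      \<le> 2 * (real (card V) / real K') + 2 * l * (real (card V) / real d)"
      using global_strip[of "W + (2 * i + 1) * g" 2 "W + (2 * i + 3) * g"] by (simp add: algebra_simps)
    moreover have "0 \<le> 2 * l * (real (card V) / real d)" using l_pos by simp
    ultimately have "real (card {u \<in> V. W + (2 * i + 1) * g \<le> c u \<and> c u < W + (2 * i + 3) * g}) \<le> real (T * h)"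
      using T_h by simp
    then have "card {u \<in> V. W + (2 * i + 1) * g \<le> c u \<and> c u < W + (2 * i + 3) * g} \<le> T * h"
      by (simp only: of_nat_le_iff)
    moreover have "card {v \<in> S. cl (c v) = j} \<le> card {u \<in> V. W + (2 * i + 1) * g \<le> c u \<and> c u < W + (2 * i + 3) * g}"
      using cl_eq_SucD Suc sgD(1) by (intro card_mono) (auto simp: S_def)
    ultimately show ?thesis by linarith
  next
    case False
    then have none: "{v \<in> S. cl (c v) = j} = {}" using cl_le c_less by (fastforce simp: S_def)
    show ?thesis unfolding none by simp
  qed
qed

text \<open>One strip meets the neighbourhood in at least \<open>d / K' - 2 * l\<close> vertices, a
  positive number by \<open>l_less\<close>.\<close>

lemma neighbour_class_0:
  assumes "v \<in> V" shows "\<exists>u\<in>N v \<inter> S. cl (c u) = 0"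
proof -
  have "W + g \<le> K" using W_eq by simp
  have "real (W + g) / real K - real W / real K = real (1 * g) / real K"
    by (simp add: diff_divide_distrib[symmetric])
  then have "real d * (real (W + g) / real K) - real d * (real W / real K) = real d / real K'"
    unfolding strip_ratio by (simp only: right_diff_distrib[symmetric]) simp
  moreover have "real (card {u \<in> N v. W \<le> c u \<and> c u < W + g})
    = real (card {u \<in> N v. c u < W + g}) - real (card {u \<in> N v. c u < W})"
    using sgD(3) by (intro card_between) auto
  ultimately have "0 < real (card {u \<in> N v. W \<le> c u \<and> c u < W + g})"
    using dev[OF assms \<open>W + g \<le> K\<close>] dev[OF assms W_le] l_less by (simp add: abs_le_iff)
  then obtain u where "u \<in> N v" "W \<le> c u" "c u < W + g"
    by (metis (no_types, lifting) card_gt_0_iff ex_in_conv mem_Collect_eq of_nat_0_less_iff)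
  then show ?thesis using cl_eq_0 sgD(2)[of v] by (auto simp: S_def)
qed

section \<open>Weights determined by the colours, and distinct weighted degrees in B\<close>

definition base :: "nat \<Rightarrow> nat" where "base q = H + 1 + r + (A + r) * cl q"

text \<open>The weight, before corrections, of an edge from a vertex of \<open>B\<close> of colour
  \<open>q\<close> to a neighbour of colour \<open>q'\<close>. The condition on
  \<open>q + q'\<close> is symmetric, so the weight is well defined inside \<open>B\<close>.\<close>

definition \<phi> :: "nat \<Rightarrow> nat \<Rightarrow> nat" where
  "\<phi> q q' = (if q' < W then (if W \<le> q + q' then 1 + H else 1) else base q')"

lemma base_mono: "q \<le> q' \<Longrightarrow> base q \<le> base q'"
  unfolding base_def using cl_mono by (intro add_mono mult_left_mono) auto

text \<open>The top class 8 with full correction has weight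
  \<open>H + 1 + r + 8 * (A + r) + A\<close>, which is where the formula for \<open>k\<close> comes
  from.\<close>

lemma base_le: "q < K \<Longrightarrow> base q + A \<le> k"
proof -
  assume "q < K"
  then have "(A + r) * cl q \<le> (A + r) * 8" using cl_le by (intro mult_left_mono) auto
  then show ?thesis by (simp add: base_def k_def)
qed

lemma \<phi>_mono: "q' \<le> q'' \<Longrightarrow> \<phi> q q' \<le> \<phi> q q''"
  using base_mono[of q' q''] by (auto simp: \<phi>_def base_def)

lemma \<phi>_le: "q' < K \<Longrightarrow> \<phi> q q' \<le> k"
  using base_le[of q'] by (auto simp: \<phi>_def k_def)

definition F\<^sub>0 :: real where "F\<^sub>0 = real d / real K * real (\<Sum>q<K. \<phi> 0 q)"

text \<open>The threshold \<open>W\<close> makes exactly \<open>q\<close> colours below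
  \<open>W\<close> heavy, namely those from \<open>W - q\<close> on. Hence the mean grows linearly
  in \<open>q\<close>.\<close>

lemma sum_\<phi>: "q < W \<Longrightarrow> (\<Sum>q'<K. \<phi> q q') = (\<Sum>q'<K. \<phi> 0 q') + H * q"
proof -
  assume q: "q < W"
  have "(\<Sum>q'<K. \<phi> q q') = (\<Sum>q'<K. \<phi> 0 q' + (if q' \<in> {W - q..<W} then H else 0))"
    by (intro sum.cong) (auto simp: \<phi>_def)
  also have "\<dots> = (\<Sum>q'<K. \<phi> 0 q') + (\<Sum>q'\<in>{..<K} \<inter> {W - q..<W}. H)"
    unfolding sum.distrib by (subst sum.inter_restrict) auto
  also have "{..<K} \<inter> {W - q..<W} = {W - q..<W}" using W_le by auto
  finally show ?thesis using q by simp
qed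

lemma F\<^sub>0_nonneg: "0 \<le> F\<^sub>0"
  unfolding F\<^sub>0_def by (intro mult_nonneg_nonneg of_nat_0_le_iff divide_nonneg_nonneg)

lemma F\<^sub>0_le: "F\<^sub>0 \<le> real d + 17 * real d * real k / real K'"
proof -
  have "(\<Sum>q<K. \<phi> 0 q) = (\<Sum>q<W. \<phi> 0 q) + (\<Sum>q=W..<K. \<phi> 0 q)"
    using W_le by (simp add: lessThan_atLeast0 sum.atLeastLessThan_concat)
  also have "\<dots> \<le> (\<Sum>q<W. 1) + (\<Sum>q=W..<K. k)"
  proof (intro add_mono sum_mono)
    show "\<phi> 0 q \<le> 1" if "q \<in> {..<W}" for q using that by (simp add: \<phi>_def)
    show "\<phi> 0 q \<le> k" if "q \<in> {W..<K}" for q using that by (intro \<phi>_le) simp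
  qed
  also have "\<dots> = W + (K - W) * k" by simp
  also have "K - W = 17 * g" using W_eq by simp
  finally have "(\<Sum>q<K. \<phi> 0 q) \<le> K + 17 * g * k" using W_le by linarith
  then have "real (\<Sum>q<K. \<phi> 0 q) \<le> real (K + 17 * g * k)" by (simp only: of_nat_le_iff)
  then have "F\<^sub>0 \<le> real d / real K * real (K + 17 * g * k)"
    unfolding F\<^sub>0_def by (intro mult_left_mono) auto
  also have "\<dots> = real d + real d * real k * (real (17 * g) / real K)"
    using K_pos by (simp add: field_simps)
  finally show ?thesis unfolding strip_ratio by (simp add: mult_ac)
qed

definition \<sigma> :: "'a \<Rightarrow> nat" where "\<sigma> v = (\<Sum>u\<in>N v. \<phi> (c v) (c u))"

lemma \<sigma>_approx:
  assumes "v \<in> B"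
  shows "\<bar>real (\<sigma> v) - (F\<^sub>0 + real H * real d * real (c v) / real K)\<bar> \<le> real k * l"
proof -
  have v: "v \<in> V" "c v < W" using assms by (auto simp: B_def)
  have "\<bar>real (\<Sum>u\<in>N v. \<phi> (c v) (c u)) - card (N v) / K * real (\<Sum>q<K. \<phi> (c v) q)\<bar> \<le> k * l"
  proof (rule sum_monotone_equidistributed)
    show "\<bar>real (card {u \<in> N v. c u < t}) - card (N v) * (t / K)\<bar> \<le> l" if "t \<le> K" for t
      using dev[OF v(1) that] deg[OF v(1)] by simp
  qed (use sgD(2,3) c_less K_pos \<phi>_mono \<phi>_le in auto)
  moreover have "card (N v) / K * real (\<Sum>q<K. \<phi> (c v) q) = F\<^sub>0 + real H * real d * real (c v) / real K"
    using sum_\<phi>[OF v(2)] deg[OF v(1)] by (simp add: F\<^sub>0_def ring_distribs)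
  ultimately show ?thesis by (simp add: \<sigma>_def)
qed

text \<open>The targets follow the rank by colour, scaled by \<open>H * d / n\<close>. This factor
  is at least 1, so rounding down keeps distinct ranks distinct, and rank and \<sigma> both follow
  the colour up to errors of order \<open>k * l\<close>.\<close>

lemma B_targets:
  "\<exists>\<tau> :: 'a \<Rightarrow> nat. inj_on \<tau> B \<and> (\<forall>v\<in>B. \<sigma> v \<le> \<tau> v \<and> \<tau> v - \<sigma> v \<le> A * card (N v \<inter> S) \<and>
    real (\<tau> v) < real (H + 1 + r) * real d - real k * (17 * real d / real K' + l))"
proof -
  define n where "n = card V"
  obtain rk :: "'a \<Rightarrow> nat" where rk: "inj_on rk V"
    "\<And>v. v \<in> V \<Longrightarrow> card {u \<in> V. c u < c v} \<le> rk v \<and> rk v < card {u \<in> V. c u < c v + 1}"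
    using rank_by_colour[OF sgD(1), of c] by blast
  \<comment> \<open>The offset makes every target at least \<sigma>: it covers the error
    \<open>H * l\<close> of the scaled rank, the error \<open>k * l\<close> of \<sigma>, and 1 for
    rounding down.\<close>
  define X where "X = nat \<lceil>F\<^sub>0 + real H * l + real k * l + 1\<rceil>"
  have arg: "0 \<le> F\<^sub>0 + real H * l + real k * l + 1" using F\<^sub>0_nonneg l_pos by simp
  have X: "F\<^sub>0 + real H * l + real k * l + 1 \<le> real X" "real X \<le> F\<^sub>0 + real H * l + real k * l + 2"
    using arg by (auto simp: X_def) linarith+
  have Hk: "real H * l \<le> real k * l" using l_pos by (intro mult_right_mono) (auto simp: k_def)
  define \<tau> where "\<tau> v = X + (rk v * (H * d)) div n" for v
  show ?thesis
  proof (intro exI[of _ \<tau>] conjI ballI inj_onI)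
    fix u v assume uv: "u \<in> B" "v \<in> B" "\<tau> u = \<tau> v"
    have n_pos: "0 < n" using uv B_S sgD(1) by (auto simp: n_def card_gt_0_iff)
    have "(a * (H * d)) div n < (b * (H * d)) div n" if "a < b" for a b
    proof -
      have "(a + 1) * (H * d) \<le> b * (H * d)" using that by (intro mult_right_mono) auto
      then have "a * (H * d) + n \<le> b * (H * d)" using H_ge by (simp add: n_def)
      then have "(a * (H * d) + n) div n \<le> (b * (H * d)) div n" by (rule div_le_mono)
      then show ?thesis using n_pos by simp
    qed
    then have "rk u = rk v" using uv(3) by (metis \<tau>_def add_left_cancel nat_neq_iff)
    then show "u = v" using rk(1) uv B_S by (auto dest: inj_onD)
  next
    fix v assume vB: "v \<in> B"
    then have v: "v \<in> V" "c v < W" by (auto simp: B_def)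
    have n_pos: "0 < n" using v sgD(1) by (auto simp: n_def card_gt_0_iff)
    define z where "z = real H * real d * real (c v) / real K"
    define x where "x = real (rk v * (H * d)) / real n"
    have lo: "z - real H * l \<le> x"
    proof -
      have "real n * (real (c v) / real K) - l * (real n / real d) \<le> real (rk v)"
        using global_dev[of "c v"] rk(2)[OF v(1)] v W_le by (simp add: n_def abs_le_iff)
      then have "(real n * (real (c v) / real K) - l * (real n / real d)) * (real (H * d) / real n)
        \<le> real (rk v) * (real (H * d) / real n)" by (intro mult_right_mono) auto
      moreover have "(real n * (real (c v) / real K) - l * (real n / real d)) * (real (H * d) / real n) = z - real H * l"
        using n_pos d_pos K_pos by (simp add: z_def field_simps)
      ultimately show ?thesis by (simp add: x_def)
    qed
    have hi: "x \<le> z + real H * (real d / real K) + real H * l"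
    proof -
      have "c v + 1 \<le> K" using v W_le by simp
      then have "real (rk v) \<le> real n * (real (c v + 1) / real K) + l * (real n / real d)"
        using global_dev[of "c v + 1"] rk(2)[OF v(1)] by (simp add: n_def abs_le_iff)
      then have "real (rk v) * (real (H * d) / real n) \<le>
        (real n * (real (c v + 1) / real K) + l * (real n / real d)) * (real (H * d) / real n)"
        by (intro mult_right_mono) auto
      moreover have "(real n * (real (c v + 1) / real K) + l * (real n / real d)) * (real (H * d) / real n)
        = z + real H * (real d / real K) + real H * l"
        using n_pos d_pos K_pos by (simp add: z_def field_simps)
      ultimately show ?thesis by (simp add: x_def)
    qed
    have div: "x - 1 \<le> real ((rk v * (H * d)) div n)" "real ((rk v * (H * d)) div n) \<le> x"
    proof -
      have "x = real ((rk v * (H * d)) div n) + real ((rk v * (H * d)) mod n) / real n"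
        unfolding x_def by (rule of_nat_of_nat_div_aux)
      moreover have "real ((rk v * (H * d)) mod n) / real n \<le> 1"
        using mod_less_divisor[OF n_pos, of "rk v * (H * d)"] by simp
      moreover have "0 \<le> real ((rk v * (H * d)) mod n) / real n" by simp
      ultimately show "x - 1 \<le> real ((rk v * (H * d)) div n)" "real ((rk v * (H * d)) div n) \<le> x"
        by linarith+
    qed
    have \<tau>_real: "real (\<tau> v) = real X + real ((rk v * (H * d)) div n)" by (simp add: \<tau>_def)
    have appr: "\<bar>real (\<sigma> v) - (F\<^sub>0 + z)\<bar> \<le> real k * l" using \<sigma>_approx[OF vB] by (simp add: z_def)
    have "real (\<sigma> v) \<le> real (\<tau> v)" using appr X lo div \<tau>_real by linarith
    then show le: "\<sigma> v \<le> \<tau> v" by simp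
    have "real H * (real d / real K) \<le> real H * l" using g_ge by (intro mult_left_mono) auto
    \<comment> \<open>The offset gives \<open>H * l + k * l + 2\<close>, the rank
      \<open>2 * H * l\<close> (one of them for the ties within a colour), and \<sigma> gives
      \<open>k * l\<close>; with \<open>H\<close> at most \<open>k\<close> this makes 5.\<close>
    then have "real (\<tau> v - \<sigma> v) \<le> 5 * real k * l + 2"
      using appr X hi div \<tau>_real le Hk by (simp add: of_nat_diff)
    also have "\<dots> \<le> real A * (17 * real d / real K' - l)" by (rule A_ge)
    also have "\<dots> \<le> real A * real (card (N v \<inter> S))"
      using S_degree[OF v(1)] by (intro mult_left_mono) auto
    finally show "\<tau> v - \<sigma> v \<le> A * card (N v \<inter> S)" by (metis of_nat_le_iff of_nat_mult)
    have "rk v < card {u \<in> V. c u < c v + 1}" using rk(2)[OF v(1)] by simp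
    also have "\<dots> \<le> n" using sgD(1) unfolding n_def by (intro card_mono) auto
    finally have "rk v * (H * d) div n \<le> n * (H * d) div n" by (intro div_le_mono mult_right_mono) auto
    then have "real ((rk v * (H * d)) div n) \<le> real H * real d" using n_pos
      by (metis nonzero_mult_div_cancel_left not_less_zero of_nat_le_iff of_nat_mult)
    then have "real (\<tau> v) \<le> real d + 17 * real d * real k / real K' + 2 * real k * l + 2 + real H * real d"
      using X F\<^sub>0_le Hk \<tau>_real by linarith
    \<comment> \<open>The numbers 34 and 3 in \<open>r_ge\<close> arise here: one share
      \<open>17 * d * k / K'\<close> comes from the bound on \<open>F\<^sub>0\<close>, an equal one
      is reserved for the edges inside \<open>S\<close>, and \<open>k * l\<close> occurs three
      times.\<close>
    also have "\<dots> < real (H + 1 + r) * real d - real k * (17 * real d / real K' + l)"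
      using r_ge by (simp add: algebra_simps)
    finally show "real (\<tau> v) < real (H + 1 + r) * real d - real k * (17 * real d / real K' + l)" .
  qed
qed

text \<open>An edge between \<open>B\<close> and \<open>S\<close> has one end in \<open>B\<close>,
  so the corrections at different vertices of \<open>B\<close> use disjoint sets of edges. Their
  effect on \<open>S\<close> is merely bounded, by \<open>A\<close> per edge.\<close>

lemma B_adjustment:
  "\<exists>\<psi> :: 'a set \<Rightarrow> nat. (\<forall>u\<in>S. \<forall>v\<in>B. {u, v} \<in> E \<longrightarrow> \<psi> {u, v} \<le> A) \<and>
    inj_on (\<lambda>v. \<sigma> v + (\<Sum>u\<in>N v \<inter> S. \<psi> {u, v})) B \<and>
    (\<forall>v\<in>B. real (\<sigma> v + (\<Sum>u\<in>N v \<inter> S. \<psi> {u, v})) <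
      real (H + 1 + r) * real d - real k * (17 * real d / real K' + l))"
proof -
  obtain \<tau> :: "'a \<Rightarrow> nat" where \<tau>: "inj_on \<tau> B" "\<And>v. v \<in> B \<Longrightarrow> \<sigma> v \<le> \<tau> v"
    "\<And>v. v \<in> B \<Longrightarrow> \<tau> v - \<sigma> v \<le> A * card (N v \<inter> S)"
    "\<And>v. v \<in> B \<Longrightarrow> real (\<tau> v) < real (H + 1 + r) * real d - real k * (17 * real d / real K' + l)"
    using B_targets by blast
  have "\<exists>p. (\<forall>u\<in>N v \<inter> S. p u \<le> A) \<and> (\<Sum>u\<in>N v \<inter> S. p u) = \<tau> v - \<sigma> v" if "v \<in> B" for v
    using \<tau>(3)[OF that] sgD(3) by (intro bounded_distribution) auto
  then obtain p where p: "\<And>v u. v \<in> B \<Longrightarrow> u \<in> N v \<inter> S \<Longrightarrow> p v u \<le> A"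
    "\<And>v. v \<in> B \<Longrightarrow> (\<Sum>u\<in>N v \<inter> S. p v u) = \<tau> v - \<sigma> v" by metis
  define \<psi> where "\<psi> e = p (the_elem (e \<inter> B)) (the_elem (e \<inter> S))" for e
  have \<psi>: "\<psi> {u, v} = p v u" if "u \<in> S" "v \<in> B" for u v
  proof -
    have "{u, v} \<inter> B = {v}" "{u, v} \<inter> S = {u}" using that B_S by auto
    then show ?thesis by (simp add: \<psi>_def)
  qed
  have total: "\<sigma> v + (\<Sum>u\<in>N v \<inter> S. \<psi> {u, v}) = \<tau> v" if "v \<in> B" for v
  proof -
    have "(\<Sum>u\<in>N v \<inter> S. \<psi> {u, v}) = (\<Sum>u\<in>N v \<inter> S. p v u)" using \<psi> that by (intro sum.cong) auto
    then show ?thesis using p(2)[OF that] \<tau>(2)[OF that] by simp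
  qed
  show ?thesis
  proof (intro exI[of _ \<psi>] conjI ballI impI)
    fix u v assume "u \<in> S" "v \<in> B" "{u, v} \<in> E"
    then show "\<psi> {u, v} \<le> A" using \<psi> p(1) by (auto simp: neighbours_def)
  next
    show "inj_on (\<lambda>v. \<sigma> v + (\<Sum>u\<in>N v \<inter> S. \<psi> {u, v})) B"
      using \<tau>(1) total by (simp cong: inj_on_cong)
  qed (use total \<tau>(4) in auto)
qed

section \<open>Separation inside the classes of S\<close>

lemma S_weighting:
  fixes s :: "'a \<Rightarrow> int"
  shows "\<exists>z :: 'a set \<Rightarrow> int. (\<forall>e\<in>E. e \<subseteq> S \<longrightarrow> 0 \<le> z e \<and> z e < 4 * int h) \<and>
    (\<forall>u\<in>S. \<forall>v\<in>S. u \<noteq> v \<longrightarrow> cl (c u) = cl (c v) \<longrightarrow>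
      s u + (\<Sum>w\<in>N u \<inter> S. z {w, u}) \<noteq> s v + (\<Sum>w\<in>N v \<inter> S. z {w, v}))"
proof -
  define F where "F = {e \<in> E. e \<subseteq> S}"
  have sgF: "simple_graph S F" using sg B_S by (auto simp: simple_graph_def F_def)
  have nb: "neighbours F v = N v \<inter> S" if "v \<in> S" for v
    using that by (auto simp: neighbours_def F_def)
  have SV: "v \<in> V" if "v \<in> S" for v using that B_S by auto
  obtain y :: "'a set \<Rightarrow> int" where y: "\<forall>e. 0 \<le> y e \<and> y e < h"
    "\<forall>j \<rho>. card {v \<in> S. cl (c v) = j \<and> (s v + (\<Sum>u\<in>neighbours F v. y {u, v})) mod h = \<rho>} \<le> T + 1"
  proof -
    have "\<exists>u\<in>neighbours F v. cl (c u) = 0" if "v \<in> S" for v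
      using neighbour_class_0[OF SV[OF that]] nb[OF that] by auto
    from balanced_residues[OF sgF h_pos card_class_0 card_class this, of s]
    show thesis using that by blast
  qed
  define s' where "s' v = s v + (\<Sum>u\<in>neighbours F v. y {u, v})" for v
  define key where "key v = (cl (c v), s' v mod h)" for v
  have "card {u \<in> S. key u = key v} \<le> T + 1" for v
    using y(2)[rule_format, of "cl (c v)" "s' v mod h"] by (simp add: key_def s'_def)
  moreover have "2 * (T + 1) \<le> card (neighbours F v)" if "v \<in> S" for v
  proof -
    have "2 * (real T + 1) \<le> real (card (N v \<inter> S))" using T_le S_degree[OF SV[OF that]] by linarith
    then have "real (2 * (T + 1)) \<le> real (card (N v \<inter> S))" by simp
    then show ?thesis unfolding nb[OF that] by (simp only: of_nat_le_iff)
  qed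
  \<comment> \<open>The separation acts on the quotients by \<open>h\<close>, among vertices with
    the same class and the same residue.\<close>
  ultimately obtain g' :: "'a set \<Rightarrow> int" where g': "\<forall>e\<in>F. g' e \<in> {0..3}"
    "\<forall>u\<in>S. \<forall>v\<in>S. u \<noteq> v \<longrightarrow> key u = key v \<longrightarrow>
      s' u div h + (\<Sum>w\<in>neighbours F u. g' {w, u}) \<noteq> s' v div h + (\<Sum>w\<in>neighbours F v. g' {w, v})"
    using distinct_sums_on_classes[OF sgF, of "T + 1" key "\<lambda>v. s' v div h"] by blast
  \<comment> \<open>Multiples of \<open>h\<close> do not disturb the residues arranged by
    \<open>y\<close>; the total stays below \<open>h + 3 * h\<close>.\<close>
  define z where "z e = y e + h * g' e" for e
  have tot: "s v + (\<Sum>w\<in>N v \<inter> S. z {w, v})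
    = s' v mod h + h * (s' v div h + (\<Sum>w\<in>neighbours F v. g' {w, v}))" if "v \<in> S" for v
  proof -
    have "s v + (\<Sum>w\<in>N v \<inter> S. z {w, v}) = s' v + h * (\<Sum>w\<in>neighbours F v. g' {w, v})"
      unfolding nb[OF that, symmetric] by (simp add: z_def s'_def sum.distrib sum_distrib_left)
    also have "s' v = s' v mod h + h * (s' v div h)" by simp
    finally show ?thesis by (simp add: distrib_left)
  qed
  show ?thesis
  proof (intro exI[of _ z] conjI ballI impI)
    fix e assume "e \<in> E" "e \<subseteq> S"
    then have "0 \<le> g' e" "g' e \<le> 3" using g'(1) by (auto simp: F_def)
    then have "0 \<le> h * g' e" "h * g' e \<le> int h * 3" by (auto intro: mult_left_mono)
    then show "0 \<le> z e" "z e < 4 * int h" using y(1)[rule_format, of e] unfolding z_def by linarith+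
  next
    fix u v assume uv: "u \<in> S" "v \<in> S" "u \<noteq> v" "cl (c u) = cl (c v)"
    show "s u + (\<Sum>w\<in>N u \<inter> S. z {w, u}) \<noteq> s v + (\<Sum>w\<in>N v \<inter> S. z {w, v})"
    proof
      assume eq: "s u + (\<Sum>w\<in>N u \<inter> S. z {w, u}) = s v + (\<Sum>w\<in>N v \<inter> S. z {w, v})"
      then have "(s' u mod h + h * (s' u div h + (\<Sum>w\<in>neighbours F u. g' {w, u}))) mod h
        = (s' v mod h + h * (s' v div h + (\<Sum>w\<in>neighbours F v. g' {w, v}))) mod h"
        unfolding tot[OF uv(1)] tot[OF uv(2)] by simp
      then have m: "s' u mod h = s' v mod h" by simp
      then have "key u = key v" using uv by (simp add: key_def)
      moreover have "s' u div h + (\<Sum>w\<in>neighbours F u. g' {w, u}) = s' v div h + (\<Sum>w\<in>neighbours F v. g' {w, v})"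
        using eq m h_pos unfolding tot[OF uv(1)] tot[OF uv(2)] by simp
      ultimately show False using g'(2) uv by blast
    qed
  qed
qed

section \<open>The combined weighting and the disjoint ranges of weighted degrees\<close>

lemma irregular_weighting_exists: "\<exists>f. irregular_weighting k V E f"
proof -
  obtain \<psi> :: "'a set \<Rightarrow> nat" where \<psi>: "\<And>u v. u \<in> S \<Longrightarrow> v \<in> B \<Longrightarrow> {u, v} \<in> E \<Longrightarrow> \<psi> {u, v} \<le> A"
    "inj_on (\<lambda>v. \<sigma> v + (\<Sum>u\<in>N v \<inter> S. \<psi> {u, v})) B"
    "\<And>v. v \<in> B \<Longrightarrow> real (\<sigma> v + (\<Sum>u\<in>N v \<inter> S. \<psi> {u, v})) <
      real (H + 1 + r) * real d - real k * (17 * real d / real K' + l)"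
    using B_adjustment by blast
  \<comment> \<open>The part of the weighted degree that is fixed before \<open>z\<close> is chosen.
    Edges inside \<open>S\<close> get weight \<open>1 + z\<close>, which explains the summand for
    the degree in \<open>S\<close>.\<close>
  define s where "s w = int (\<Sum>u\<in>N w \<inter> B. base (c w) + \<psi> {w, u}) + int (card (N w \<inter> S))" for w
  obtain z :: "'a set \<Rightarrow> int" where z: "\<And>e. e \<in> E \<Longrightarrow> e \<subseteq> S \<Longrightarrow> 0 \<le> z e \<and> z e < 4 * int h"
    "\<And>u v. u \<in> S \<Longrightarrow> v \<in> S \<Longrightarrow> u \<noteq> v \<Longrightarrow> cl (c u) = cl (c v) \<Longrightarrow>
      s u + (\<Sum>w\<in>N u \<inter> S. z {w, u}) \<noteq> s v + (\<Sum>w\<in>N v \<inter> S. z {w, v})"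
    using S_weighting[of s] by blast
  \<comment> \<open>On an edge between \<open>B\<close> and \<open>S\<close> the larger colour is
    that of the end in \<open>S\<close>, since \<open>W\<close> separates the two ranges of
    colours.\<close>
  define f where "f e = (if e \<subseteq> B then (if W \<le> (\<Sum>v\<in>e. c v) then 1 + H else 1)
    else if e \<subseteq> S then nat (1 + z e) else base (Max (c ` e)) + \<psi> e)" for e
  have fBB: "f {u, v} = \<phi> (c v) (c u)" if "u \<in> B" "v \<in> B" "u \<noteq> v" for u v
    using that by (simp add: f_def \<phi>_def B_def add.commute)
  have fSS: "f {u, v} = nat (1 + z {u, v})" if "u \<in> S" "v \<in> S" for u v
    using that B_S by (auto simp: f_def)
  have fSB: "f {u, v} = base (c u) + \<psi> {u, v}" if "u \<in> S" "v \<in> B" for u v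
  proof -
    have "Max (c ` {u, v}) = c u" using that by (auto simp: S_def B_def max_def)
    moreover have "({u, v} \<subseteq> B) = False" "({u, v} \<subseteq> S) = False" using that B_S by auto
    ultimately show ?thesis by (simp only: f_def if_False)
  qed
  have split: "(\<Sum>u\<in>N v. F u) = (\<Sum>u\<in>N v \<inter> B. F u) + (\<Sum>u\<in>N v \<inter> S. F u)" for F :: "'a \<Rightarrow> 'b :: comm_monoid_add" and v
  proof -
    have "N v = (N v \<inter> B) \<union> (N v \<inter> S)" using sgD(2)[of v] B_S by auto
    then have "(\<Sum>u\<in>N v. F u) = (\<Sum>u\<in>(N v \<inter> B) \<union> (N v \<inter> S). F u)" by simp
    also have "\<dots> = (\<Sum>u\<in>N v \<inter> B. F u) + (\<Sum>u\<in>N v \<inter> S. F u)"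
      using sgD(3) B_S by (intro sum.union_disjoint) auto
    finally show ?thesis .
  qed
  have wdB: "weighted_degree E f v = \<sigma> v + (\<Sum>u\<in>N v \<inter> S. \<psi> {u, v})" if v: "v \<in> B" for v
  proof -
    have "(\<Sum>u\<in>N v \<inter> B. f {u, v}) = (\<Sum>u\<in>N v \<inter> B. \<phi> (c v) (c u))"
      using fBB v sgD(4) by (intro sum.cong) auto
    moreover have "(\<Sum>u\<in>N v \<inter> S. f {u, v}) = (\<Sum>u\<in>N v \<inter> S. \<phi> (c v) (c u) + \<psi> {u, v})"
      using fSB v by (intro sum.cong) (auto simp: \<phi>_def S_def)
    ultimately show ?thesis
      by (simp add: weighted_degree_def split[of "\<lambda>u. f {u, v}"] \<sigma>_def split[of "\<lambda>u. \<phi> (c v) (c u)"] sum.distrib)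
  qed
  have zE: "0 \<le> z {u, w} \<and> z {u, w} < 4 * int h" if "w \<in> S" "u \<in> N w \<inter> S" for u w
    using that z(1)[of "{u, w}"] by (auto simp: neighbours_def)
  have wdS: "int (weighted_degree E f w) = s w + (\<Sum>u\<in>N w \<inter> S. z {u, w})" if w: "w \<in> S" for w
  proof -
    have "(\<Sum>u\<in>N w \<inter> B. f {u, w}) = (\<Sum>u\<in>N w \<inter> B. base (c w) + \<psi> {w, u})"
      using fSB[OF w] by (intro sum.cong) (auto simp: insert_commute)
    moreover have "int (\<Sum>u\<in>N w \<inter> S. f {u, w}) = (\<Sum>u\<in>N w \<inter> S. 1 + z {u, w})"
      unfolding of_nat_sum using fSS[OF _ w] zE[OF w] by (intro sum.cong) auto
    ultimately show ?thesis
      by (simp add: weighted_degree_def split[of "\<lambda>u. f {u, w}"] s_def sum.distrib)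
  qed
  \<comment> \<open>An upper bound for the number of neighbours in \<open>S\<close>. The edges
    inside \<open>S\<close> contribute at most \<open>k * q\<close>, and their absence from the sum
    over \<open>B\<close> costs at most \<open>k * q\<close>.\<close>
  define q where "q = 17 * real d / real K' + l"
  have bounds: "real (base (c w)) * real d - real k * q \<le> real (weighted_degree E f w)"
    "real (weighted_degree E f w) \<le> real (base (c w) + A) * real d + real k * q" if w: "w \<in> S" for w
  proof -
    have wV: "w \<in> V" "c w < K" using w B_S c_less by auto
    have "card (N w) = card (N w \<inter> B) + card (N w \<inter> S)"
      using split[of "\<lambda>_. 1 :: nat" w] by simp
    then have dB: "real (card (N w \<inter> B)) = real d - real (card (N w \<inter> S))" using deg[OF wV(1)] by simp
    have dS: "real (card (N w \<inter> S)) \<le> q" using S_degree[OF wV(1)] by (simp add: q_def)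
    have q0: "0 \<le> q" using dS by (meson of_nat_0_le_iff order_trans)
    have bk: "base (c w) + A \<le> k" using base_le[OF wV(2)] .
    have const: "real (\<Sum>u\<in>N w \<inter> B. a) = real (card (N w \<inter> B)) * real a" for a :: nat by simp
    have "real (\<Sum>u\<in>N w \<inter> B. base (c w) + \<psi> {w, u}) \<le> real (card (N w \<inter> B)) * real (base (c w) + A)"
    proof -
      have "(\<Sum>u\<in>N w \<inter> B. base (c w) + \<psi> {w, u}) \<le> (\<Sum>u\<in>N w \<inter> B. base (c w) + A)"
        using \<psi>(1)[OF w] by (intro sum_mono) (auto simp: neighbours_def insert_commute)
      then show ?thesis unfolding const[symmetric] by (simp only: of_nat_le_iff)
    qed
    also have "\<dots> \<le> real d * real (base (c w) + A)" using dB by (intro mult_right_mono) auto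
    finally have up1: "real (\<Sum>u\<in>N w \<inter> B. base (c w) + \<psi> {w, u}) \<le> real (base (c w) + A) * real d"
      by (simp add: mult.commute)
    have lo1: "real (base (c w)) * real d - real k * q \<le> real (\<Sum>u\<in>N w \<inter> B. base (c w) + \<psi> {w, u})"
    proof -
      have "(\<Sum>u\<in>N w \<inter> B. base (c w)) \<le> (\<Sum>u\<in>N w \<inter> B. base (c w) + \<psi> {w, u})"
        by (intro sum_mono) auto
      then have "real (card (N w \<inter> B)) * real (base (c w)) \<le> real (\<Sum>u\<in>N w \<inter> B. base (c w) + \<psi> {w, u})"
        unfolding const[symmetric] by (simp only: of_nat_le_iff)
      moreover have "real (card (N w \<inter> S)) * real (base (c w)) \<le> q * real k"
        using dS q0 bk by (intro mult_mono) auto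
      ultimately show ?thesis using dB by (simp add: algebra_simps)
    qed
    have "real_of_int (\<Sum>u\<in>N w \<inter> S. 1 + z {u, w}) \<le> real k * q"
    proof -
      have "(\<Sum>u\<in>N w \<inter> S. 1 + z {u, w}) \<le> (\<Sum>u\<in>N w \<inter> S. int k)"
        using zE[OF w] h_le by (intro sum_mono) force
      then have "real_of_int (\<Sum>u\<in>N w \<inter> S. 1 + z {u, w}) \<le> real_of_int (\<Sum>u\<in>N w \<inter> S. int k)"
        by (simp only: of_int_le_iff)
      also have "\<dots> = real k * real (card (N w \<inter> S))" by simp
      also have "\<dots> \<le> real k * q" using dS by (intro mult_left_mono) auto
      finally show ?thesis .
    qed
    moreover have "0 \<le> (\<Sum>u\<in>N w \<inter> S. 1 + z {u, w})"
      using zE[OF w] by (intro sum_nonneg) force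
    then have "0 \<le> real_of_int (\<Sum>u\<in>N w \<inter> S. 1 + z {u, w})" by (simp only: of_int_0_le_iff)
    moreover have "real (weighted_degree E f w) = real (\<Sum>u\<in>N w \<inter> B. base (c w) + \<psi> {w, u})
      + real_of_int (\<Sum>u\<in>N w \<inter> S. 1 + z {u, w})"
    proof -
      have "int (weighted_degree E f w) = int (\<Sum>u\<in>N w \<inter> B. base (c w) + \<psi> {w, u}) + (\<Sum>u\<in>N w \<inter> S. 1 + z {u, w})"
        using wdS[OF w] by (simp add: s_def sum.distrib)
      then have "real_of_int (int (weighted_degree E f w)) = real_of_int (int (\<Sum>u\<in>N w \<inter> B. base (c w) + \<psi> {w, u}) + (\<Sum>u\<in>N w \<inter> S. 1 + z {u, w}))"
        by (rule arg_cong)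
      then show ?thesis by (simp only: of_int_add of_int_of_nat_eq)
    qed
    ultimately show "real (base (c w)) * real d - real k * q \<le> real (weighted_degree E f w)"
      "real (weighted_degree E f w) \<le> real (base (c w) + A) * real d + real k * q"
      using lo1 up1 by linarith+
  qed
  have BS: "weighted_degree E f v < weighted_degree E f w" if "v \<in> B" "w \<in> S" for v w
  proof -
    have "real (weighted_degree E f v) < real (H + 1 + r) * real d - real k * q"
      using \<psi>(3)[OF that(1)] wdB[OF that(1)] by (simp add: q_def)
    also have "\<dots> \<le> real (base (c w)) * real d - real k * q"
      by (intro diff_right_mono mult_right_mono) (auto simp: base_def)
    also have "\<dots> \<le> real (weighted_degree E f w)" using bounds(1)[OF that(2)] .
    finally show ?thesis by simp
  qed
  \<comment> \<open>The ranges of consecutive classes are \<open>r * d\<close> apart before the two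
    errors \<open>k * q\<close> are deducted.\<close>
  have SS: "weighted_degree E f v < weighted_degree E f w" if vw: "v \<in> S" "w \<in> S" "cl (c v) < cl (c w)" for v w
  proof -
    have "(A + r) * (cl (c v) + 1) \<le> (A + r) * cl (c w)" using vw by (intro mult_left_mono) auto
    then have "base (c v) + A + r \<le> base (c w)" by (simp add: base_def)
    then have "real (base (c v) + A + r) * real d \<le> real (base (c w)) * real d"
      by (intro mult_right_mono) auto
    moreover have "2 * (real k * q) < real r * real d"
    proof -
      have "0 \<le> real k * l" using l_pos by simp
      moreover have "2 * (real k * q) = 34 * real d * real k / real K' + 2 * (real k * l)"
        by (simp add: q_def algebra_simps)
      ultimately show ?thesis using r_ge by linarith
    qed
    ultimately have "real (weighted_degree E f v) < real (weighted_degree E f w)"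
      using bounds(2)[OF vw(1)] bounds(1)[OF vw(2)] by (simp add: algebra_simps)
    then show ?thesis by simp
  qed
  have "irregular_weighting k V E f"
    unfolding irregular_weighting_def
  proof (intro conjI ballI inj_onI)
    fix e assume e: "e \<in> E"
    then have "e \<subseteq> V" "card e = 2" using sg by (auto simp: simple_graph_def)
    then obtain u v where uv: "e = {u, v}" "u \<noteq> v" "u \<in> V" "v \<in> V" by (auto simp: card_2_iff)
    have SB: "f {a, b} \<in> {1..k}" if "a \<in> S" "b \<in> B" "{a, b} \<in> E" for a b
    proof -
      have "c a < K" using that c_less B_S by auto
      then show ?thesis using fSB[OF that(1,2)] \<psi>(1)[OF that] base_le[of "c a"] by (simp add: base_def)
    qed
    consider "u \<in> B" "v \<in> B" | "u \<in> S" "v \<in> S" | "u \<in> S" "v \<in> B" | "v \<in> S" "u \<in> B"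
      using uv B_S by blast
    then show "f e \<in> {1..k}"
    proof cases
      case 1
      then show ?thesis using uv fBB by (auto simp: \<phi>_def B_def k_def)
    next
      case 2
      then have "0 \<le> z e" "z e < 4 * int h" using z(1)[OF e] uv by auto
      then show ?thesis using uv 2 fSS h_le by auto
    next
      case 3
      then show ?thesis using SB uv e by auto
    next
      case 4
      then show ?thesis using SB[of v u] uv e by (auto simp: insert_commute)
    qed
  next
    fix u v assume uv: "u \<in> V" "v \<in> V" "weighted_degree E f u = weighted_degree E f v"
    consider "u \<in> B" "v \<in> B" | "u \<in> S" "v \<in> S" | "u \<in> S" "v \<in> B" | "v \<in> S" "u \<in> B"
      using uv B_S by blast
    then show "u = v"
    proof cases
      case 1
      then show ?thesis using \<psi>(2) uv(3) wdB by (auto dest: inj_onD)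
    next
      case 2
      then have "cl (c u) = cl (c v)" using SS uv(3) by (metis less_irrefl nat_neq_iff)
      moreover have "s u + (\<Sum>w\<in>N u \<inter> S. z {w, u}) = s v + (\<Sum>w\<in>N v \<inter> S. z {w, v})"
        using wdS[OF 2(1)] wdS[OF 2(2)] uv(3) by simp
      ultimately show ?thesis using z(2) 2 by blast
    next
      case 3
      then show ?thesis using BS uv(3) by force
    next
      case 4
      then show ?thesis using BS uv(3) by force
    qed
  qed
  then show ?thesis by blast
qed

end

section \<open>Asymptotics\<close>

text \<open>
  With \<open>k \<le> 22 * x\<close> and \<open>x * l \<ge> 1\<close>, the requirements on \<open>A\<close> and \<open>r\<close> involve
  \<open>5 * k * l + 2 \<le> 112 * x * l\<close>, \<open>34 * k \<le> 748 * x\<close> and \<open>3 * k * l + 2 \<le> 68 * x * l\<close>.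
\<close>

definition large_degree :: "real \<Rightarrow> real \<Rightarrow> real \<Rightarrow> bool" where
  "large_degree b e x \<longleftrightarrow> 1 \<le> x \<and> 18 \<le> x powr (b + e) \<and>
    33 * x powr (1/2 + e) + 4 \<le> x / (x powr (b + e) + 1) \<and>
    40 * x ^ 3 * exp (- (x powr (2 * e) / 4)) \<le> 1 \<and>
    (x powr (b + e) + 1) * (sqrt x + 1) + 1 \<le> 5 * x \<and>
    112 * (x powr (1/2 + e) * (x powr (b + e) + 1) / x) \<le> 1 / (30 * x powr b) \<and>
    748 / x powr (b + e) \<le> 1 / (30 * x powr b) \<and>
    68 * (x powr (1/2 + e) / x) \<le> 1 / (30 * x powr b)"

text \<open>Comparing exponents in the condition with 112 gives
  \<open>b + 2 * e - 1/2 < - b\<close>, which is exactly \<open>b + e < 1/4\<close>. The exponential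
  condition and the one with 748 rest on \<open>0 < e\<close>.\<close>

lemma eventually_large_degree:
  fixes b e :: real
  assumes "0 < b" "0 < e" "b + e < 1/4"
  shows "eventually (large_degree b e) at_top"
proof -
  have 1: "eventually (\<lambda>x::real. 33 * x powr (1/2 + e) + 4 \<le> x / (x powr (b + e) + 1)) at_top"
    using assms by real_asymp
  have 2: "eventually (\<lambda>x::real. 40 * x ^ 3 * exp (- (x powr (2 * e) / 4)) \<le> 1) at_top"
    using assms by real_asymp
  have 3: "eventually (\<lambda>x::real. (x powr (b + e) + 1) * (sqrt x + 1) + 1 \<le> 5 * x) at_top"
    using assms by real_asymp
  have 4: "eventually (\<lambda>x::real. 18 \<le> x powr (b + e)) at_top"
    using assms by real_asymp
  have 5: "eventually (\<lambda>x::real. 112 * (x powr (1/2 + e) * (x powr (b + e) + 1) / x) \<le> 1 / (30 * x powr b)) at_top"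
    using assms by real_asymp
  have 6: "eventually (\<lambda>x::real. 748 / x powr (b + e) \<le> 1 / (30 * x powr b)) at_top"
    using assms by real_asymp
  have 7: "eventually (\<lambda>x::real. 68 * (x powr (1/2 + e) / x) \<le> 1 / (30 * x powr b)) at_top"
    using assms by real_asymp
  show ?thesis
    unfolding large_degree_def
    using eventually_ge_at_top[of "1::real"] 1 2 3 4 5 6 7
    by (auto intro!: eventually_conj)
qed

lemma regular_graph_card:
  assumes "regular_graph d V E" "V \<noteq> {}"
  shows "d < card V"
proof -
  have sg: "simple_graph V E" and deg: "\<And>v. v \<in> V \<Longrightarrow> card (neighbours E v) = d"
    using assms by (auto simp: regular_graph_def)
  obtain v where v: "v \<in> V" using assms(2) by auto
  have "neighbours E v \<subset> V" using simple_graphD(2,4)[OF sg, of v] v by auto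
  then have "card (neighbours E v) < card V" using simple_graphD(1)[OF sg] by (simp add: psubset_card_mono)
  then show ?thesis using deg[OF v] by simp
qed

lemma nat_ceiling_bounds:
  fixes y :: real assumes "0 \<le> y" shows "y \<le> real (nat \<lceil>y\<rceil>)" "real (nat \<lceil>y\<rceil>) \<le> y + 1"
proof -
  have "real (nat \<lceil>y\<rceil>) = of_int \<lceil>y\<rceil>" using assms by simp
  then show "y \<le> real (nat \<lceil>y\<rceil>)" "real (nat \<lceil>y\<rceil>) \<le> y + 1" by linarith+
qed

lemma nat_floor_bounds:
  fixes y :: real assumes "0 \<le> y"
  shows "y < real (nat \<lfloor>y\<rfloor> + 1)" "real (nat \<lfloor>y\<rfloor> + 1) \<le> y + 1"
proof -
  have "real (nat \<lfloor>y\<rfloor> + 1) = of_int \<lfloor>y\<rfloor> + 1" using assms by simp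
  then show "y < real (nat \<lfloor>y\<rfloor> + 1)" "real (nat \<lfloor>y\<rfloor> + 1) \<le> y + 1" by linarith+
qed

lemma irregular_weighting_bound:
  fixes b e :: real and d :: nat
  assumes large: "large_degree b e (real d)" and "0 < b" "0 < e"
    and reg: "regular_graph d V E" and ne: "V \<noteq> {}"
  shows "\<exists>k\<ge>1. (\<exists>f. irregular_weighting k V E f) \<and>
    real k < real (card V) / real d * (1 + 14 / real d powr b) + 28"
proof -
  define D where "D = real d"
  define R where "R = D powr (b + e)"
  define l where "l = D powr (1/2 + e)"
  define P where "P = D powr b"
  define x where "x = real (card V) / D"
  note lg = large[unfolded large_degree_def, folded D_def, folded R_def l_def P_def]
  have D1: "1 \<le> D" and R18: "18 \<le> R" and c1: "33 * l + 4 \<le> D / (R + 1)"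
    and c2: "40 * D ^ 3 * exp (- (D powr (2 * e) / 4)) \<le> 1"
    and c3: "(R + 1) * (sqrt D + 1) + 1 \<le> 5 * D"
    and c4: "112 * (l * (R + 1) / D) \<le> 1 / (30 * P)" and c5: "748 / R \<le> 1 / (30 * P)"
    and c6: "68 * (l / D) \<le> 1 / (30 * P)"
    using lg by auto
  have d_pos: "0 < d" using D1 by (auto simp: D_def intro!: Nat.gr0I)
  have P1: "1 \<le> P" unfolding P_def using D1 assms by (intro ge_one_powr_ge_zero) auto
  have sqrt_l: "sqrt D \<le> l"
  proof -
    have "sqrt D = D powr (1/2)" using D1 by (simp add: powr_half_sqrt)
    also have "\<dots> \<le> l" unfolding l_def using D1 assms by (intro powr_mono) auto
    finally show ?thesis .
  qed
  have l1: "1 \<le> l" using sqrt_l D1 by (meson order_trans real_sqrt_ge_1_iff)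
  have x1: "1 \<le> x" using regular_graph_card[OF reg ne] d_pos by (simp add: x_def D_def)
  define K' where "K' = nat \<lceil>R\<rceil>"
  have K': "R \<le> real K'" "real K' \<le> R + 1" unfolding K'_def using R18 by (intro nat_ceiling_bounds; simp)+
  have K'18: "18 \<le> K'" using K' R18 by linarith
  \<comment> \<open>Wide enough strips for \<open>d / K\<close> to be at most \<open>sqrt D\<close>,
    hence at most \<open>l\<close>, so ties within a colour cost no more than the deviation; yet
    \<open>K\<close> stays linear in \<open>D\<close> for the union bound.\<close>
  define g where "g = nat \<lceil>sqrt D\<rceil>"
  have g: "sqrt D \<le> real g" "real g \<le> sqrt D + 1" unfolding g_def using D1 by (intro nat_ceiling_bounds; simp)+
  have sqrtD1: "1 \<le> sqrt D" using D1 by simp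
  have g_pos: "0 < g" using g sqrtD1 by (auto intro!: Nat.gr0I)
  have DK': "D / (R + 1) \<le> D / real K'" using K' D1 K'18 by (intro divide_left_mono) auto
  define K where "K = K' * g"
  define H where "H = nat \<lceil>x\<rceil>"
  have H: "x \<le> real H" "real H \<le> x + 1" unfolding H_def using x1 by (intro nat_ceiling_bounds; simp)+
  define h where "h = nat \<lceil>x / 4\<rceil>"
  have h: "x / 4 \<le> real h" "real h \<le> x / 4 + 1" unfolding h_def using x1 by (intro nat_ceiling_bounds; simp)+
  have h_pos: "0 < h" using h x1 by (auto intro!: Nat.gr0I)
  define A where "A = nat \<lceil>112 * x * l * real K' / D\<rceil>"
  have A_arg: "0 < 112 * x * l * real K' / D" using x1 l1 K'18 D1 by simp
  have A: "112 * x * l * real K' / D \<le> real A" "real A \<le> 112 * x * l * real K' / D + 1"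
    unfolding A_def using A_arg by (intro nat_ceiling_bounds; simp)+
  have A1: "1 \<le> A" using A A_arg by (auto intro!: Suc_leI Nat.gr0I)
  \<comment> \<open>Floor plus one, since \<open>r_ge\<close> is strict.\<close>
  define r where "r = nat \<lfloor>748 * x / real K' + 68 * x * l / D\<rfloor> + 1"
  have r_arg: "0 \<le> 748 * x / real K' + 68 * x * l / D" using x1 l1 D1 by simp
  have r: "748 * x / real K' + 68 * x * l / D < real r"
    "real r \<le> 748 * x / real K' + 68 * x * l / D + 1"
    unfolding r_def using nat_floor_bounds[OF r_arg] by simp_all
  \<comment> \<open>With \<open>h\<close> at least \<open>x / 4\<close>, the bound on
    \<open>T * h\<close> becomes \<open>8 * D / K' + 16 * l < T\<close>. Then
    \<open>2 * (T + 1)\<close> is at most \<open>16 * D / K' + 32 * l + 4\<close>, which leads to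
    the condition with 33 in \<open>large_degree\<close>.\<close>
  define T where "T = nat \<lfloor>8 * D / real K' + 16 * l\<rfloor> + 1"
  have T_arg: "0 \<le> 8 * D / real K' + 16 * l" using l1 D1 by simp
  have T: "8 * D / real K' + 16 * l < real T" "real T \<le> 8 * D / real K' + 16 * l + 1"
    unfolding T_def using nat_floor_bounds[OF T_arg] by simp_all
  define k where "k = H + 1 + 9 * A + 9 * r"
  have A_small: "real A \<le> x / (30 * P) + 1"
  proof -
    have "112 * x * l * real K' / D \<le> 112 * x * l * (R + 1) / D"
      using K' x1 l1 D1 by (intro divide_right_mono mult_left_mono) auto
    also have "\<dots> = x * (112 * (l * (R + 1) / D))" by simp
    also have "\<dots> \<le> x * (1 / (30 * P))" using c4 x1 by (intro mult_left_mono) auto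
    finally show ?thesis using A by simp
  qed
  have r_small: "real r \<le> x / (15 * P) + 1"
  proof -
    have "748 * x / real K' \<le> 748 * x / R"
      using K' x1 R18 by (intro divide_left_mono) auto
    also have "\<dots> = x * (748 / R)" by simp
    also have "\<dots> \<le> x * (1 / (30 * P))" using c5 x1 by (intro mult_left_mono) auto
    finally have 1: "748 * x / real K' \<le> x / (30 * P)" by simp
    have "68 * x * l / D = x * (68 * (l / D))" by simp
    also have "\<dots> \<le> x * (1 / (30 * P))" using c6 x1 by (intro mult_left_mono) auto
    finally have 2: "68 * x * l / D \<le> x / (30 * P)" by simp
    have "x / (30 * P) + x / (30 * P) = x / (15 * P)" by simp
    then show ?thesis using 1 2 r by linarith
  qed
  have xP: "x / P \<le> x" "0 \<le> x / P" using P1 x1 by (auto simp: divide_le_eq)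
  \<comment> \<open>The 20 collects the roundings of \<open>H\<close>, \<open>A\<close> and
    \<open>r\<close> and the summand 1 of \<open>k\<close>: 1 + 9 + 9 + 1. The rest is
    \<open>9/30 + 9/15 = 9/10\<close> of \<open>x / P\<close>.\<close>
  have k_bound: "real k \<le> x + 20 + x / P"
  proof -
    have "9 * (x / (30 * P)) + 9 * (x / (15 * P)) \<le> x / P" using xP by simp
    moreover have "real k = real H + 1 + 9 * real A + 9 * real r" by (simp add: k_def)
    ultimately show ?thesis using A_small r_small H by linarith
  qed
  have k22: "real k \<le> 22 * x" using k_bound xP x1 by linarith
  have xl: "1 \<le> x * l" using x1 l1 by (metis mult_mono mult_1 zero_le_one order_trans)
  have kl: "real k * l \<le> 22 * (x * l)" using k22 l1 by (simp add: mult_right_mono flip: mult.assoc)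
  have l_DK': "l \<le> D / real K'" "33 * l + 4 \<le> D / real K'" using c1 DK' l1 by linarith+
  have rare: "real (K + 1) * (2 * exp (- (l\<^sup>2 / (4 * real d)))) * (4 * (real d)\<^sup>2) \<le> 1"
  proof -
    \<comment> \<open>The extra \<open>e\<close> in the exponent of \<open>l\<close> leaves a power
      of \<open>D\<close> in the exponential, which beats the polynomial factor
      \<open>40 * D ^ 3\<close>.\<close>
    have expo: "l\<^sup>2 / (4 * real d) = D powr (2 * e) / 4"
    proof -
      have "l\<^sup>2 = D powr (1/2 + e + (1/2 + e))" by (simp only: l_def power2_eq_square powr_add)
      also have "1/2 + e + (1/2 + e) = 1 + 2 * e" by simp
      finally have "l\<^sup>2 = D * D powr (2 * e)" using D1 by (simp add: powr_add)
      then show ?thesis using D1 by (simp add: D_def)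
    qed
    have "real (K + 1) \<le> 5 * D"
    proof -
      have "real K' * real g \<le> (R + 1) * (sqrt D + 1)" using K' g R18 D1 by (intro mult_mono) auto
      then show ?thesis using c3 by (simp add: K_def)
    qed
    then have "real (K + 1) * (2 * exp (- (D powr (2 * e) / 4))) * (4 * D\<^sup>2)
      \<le> 5 * D * (2 * exp (- (D powr (2 * e) / 4))) * (4 * D\<^sup>2)"
      by (intro mult_right_mono) auto
    moreover have "5 * D * (2 * exp (- (D powr (2 * e) / 4))) * (4 * D\<^sup>2) = 40 * D ^ 3 * exp (- (D powr (2 * e) / 4))"
      by (simp add: power2_eq_square power3_eq_cube)
    ultimately show ?thesis unfolding expo using c2 unfolding D_def by linarith
  qed
  have l_2d: "l \<le> real (2 * d)"
  proof -
    have "D / real K' \<le> D" using K'18 D1 by (simp add: divide_le_eq)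
    then show ?thesis using l_DK' D1 by (simp add: D_def)
  qed
  have "0 < K" using g_pos K'18 by (simp add: K_def)
  obtain c where c: "\<And>v. v \<in> V \<Longrightarrow> c v < K"
    "\<And>v t. v \<in> V \<Longrightarrow> t \<le> K \<Longrightarrow> \<bar>real (card {u \<in> neighbours E v. c u < t}) - real d * (real t / real K)\<bar> \<le> l"
    using balanced_colouring[OF reg d_pos \<open>0 < K\<close> _ l_2d] rare l1 by auto
  have "strip_weighting V E d K' g H h A r T c l"
    unfolding strip_weighting_def
  proof (intro conjI allI impI, fold k_def K_def D_def)
    have "x * D = real (card V)" using D1 by (simp add: x_def)
    then show "card V \<le> H * d" using H D1
      by (metis D_def mult_right_mono of_nat_0_le_iff of_nat_le_iff of_nat_mult)
    show "5 * real k * l + 2 \<le> real A * (17 * D / real K' - l)"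
    proof -
      have "5 * real k * l + 2 \<le> 112 * (x * l)" using kl xl by simp
      also have "\<dots> = 112 * x * l * real K' / D * (D / real K')" using D1 K'18 by simp
      also have "\<dots> \<le> real A * (D / real K')" using A D1 by (intro mult_right_mono) auto
      also have "\<dots> \<le> real A * (17 * D / real K' - l)"
      proof (intro mult_left_mono)
        have "0 \<le> D / real K'" using D1 by simp
        then show "D / real K' \<le> 17 * D / real K' - l" using l_DK' by simp
      qed simp
      finally show ?thesis .
    qed
    show "34 * D * real k / real K' + 3 * real k * l + 2 < real r * D"
    proof -
      have "34 * D * real k / real K' \<le> 34 * D * (22 * x) / real K'"
        using k22 D1 by (intro divide_right_mono mult_left_mono) auto
      also have "\<dots> = 748 * x / real K' * D" by simp
      finally have "34 * D * real k / real K' + 3 * real k * l + 2 \<le> 748 * x / real K' * D + 68 * x * l"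
        using kl xl by simp
      also have "\<dots> = (748 * x / real K' + 68 * x * l / D) * D" using D1 by (simp add: distrib_right)
      also have "\<dots> < real r * D" using r D1 by (intro mult_strict_right_mono) auto
      finally show ?thesis .
    qed
    show "2 * real (card V) / real K' + 4 * l * (real (card V) / D) < real T * real h"
    proof -
      have "2 * real (card V) / real K' + 4 * l * (real (card V) / D) = (8 * D / real K' + 16 * l) * (x / 4)"
        using D1 by (simp add: x_def field_simps)
      also have "\<dots> < real T * (x / 4)" using T x1 by (intro mult_strict_right_mono) auto
      also have "\<dots> \<le> real T * real h" using h by (intro mult_left_mono) auto
      finally show ?thesis .
    qed
    show "2 * (real T + 1) \<le> 17 * D / real K' - l" using T l_DK' by simp
    show "2 * l < D / real K'" using l_DK' l1 by simp
    show "4 * h \<le> k"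
    proof -
      have "real (4 * h) \<le> real k" using h H A1 r_def by (simp add: k_def)
      then show ?thesis by (simp only: of_nat_le_iff)
    qed
    show "D / real K \<le> l"
    proof -
      have "sqrt D * 1 \<le> real g * real K'" using g K'18 sqrtD1 by (intro mult_mono) auto
      then have "D / real K \<le> D / sqrt D"
        using sqrtD1 D1 \<open>0 < K\<close> by (intro divide_left_mono) (auto simp: K_def mult.commute)
      also have "\<dots> = sqrt D" using D1 by (simp add: real_div_sqrt)
      finally show ?thesis using sqrt_l by simp
    qed
  qed (use reg d_pos g_pos K'18 h_pos c in \<open>auto simp: D_def\<close>)
  then have "\<exists>f. irregular_weighting k V E f"
    unfolding k_def by (rule strip_weighting.irregular_weighting_exists)
  moreover have "real k < x * (1 + 14 / P) + 28"
  proof -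
    have "x * (1 + 14 / P) = x + 14 * (x / P)" by (simp add: distrib_left)
    then show ?thesis using k_bound xP by linarith
  qed
  ultimately show ?thesis by (intro exI[of _ k]) (auto simp: k_def x_def P_def D_def)
qed

theorem theorem3:
  fixes \<beta> :: real
  assumes "0 < \<beta>" and "\<beta> < 1 / 4"
  shows "\<exists>d\<^sub>0::nat. \<forall>d\<ge>d\<^sub>0. \<forall>(V::'a set) E. regular_graph d V E \<longrightarrow>
    ereal_of_enat (irregularity_strength V E)
      < ereal (real (card V) / real d * (1 + 14 / real d powr \<beta>) + 28)"
proof -
  \<comment> \<open>Half of the room below 1/4, so that both \<open>e\<close> and
    \<open>1/4 - (\<beta> + e)\<close> are positive.\<close>
  define e where "e = (1/4 - \<beta>) / 2"
  have e: "0 < e" "\<beta> + e < 1/4" using assms by (auto simp: e_def field_simps)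
  have "eventually (\<lambda>d. large_degree \<beta> e (real d)) sequentially"
    using eventually_large_degree[OF assms(1) e] filterlim_real_sequentially
    by (rule eventually_compose_filterlim)
  then obtain d\<^sub>0 where d0: "\<And>d. d \<ge> d\<^sub>0 \<Longrightarrow> large_degree \<beta> e (real d)"
    by (auto simp: eventually_sequentially)
  have "ereal_of_enat (irregularity_strength V E)
      < ereal (real (card V) / real d * (1 + 14 / real d powr \<beta>) + 28)"
    if d: "d \<ge> d\<^sub>0" and reg: "regular_graph d V E" for d and V :: "'a set" and E
  proof -
    have "\<exists>k\<ge>1. (\<exists>f. irregular_weighting k V E f) \<and>
      real k < real (card V) / real d * (1 + 14 / real d powr \<beta>) + 28"
    \<comment> \<open>The bound \<open>d < card V\<close>, and with it \<open>1 \<le> x\<close>,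
      needs a vertex; the empty graph has strength 1, below 28.\<close>
    proof (cases "V = {}")
      case True
      then have "E = {}" using reg by (auto simp: regular_graph_def simple_graph_def)
      then have "irregular_weighting 1 V E (\<lambda>_. 1)" using True by (simp add: irregular_weighting_def)
      then show ?thesis using True by (intro exI[of _ 1]) auto
    next
      case False
      then show ?thesis using irregular_weighting_bound[OF d0[OF d] assms(1) e(1) reg] by blast
    qed
    then obtain k f where k: "k \<ge> 1" "irregular_weighting k V E f"
      "real k < real (card V) / real d * (1 + 14 / real d powr \<beta>) + 28" by blast
    then have "irregularity_strength V E \<le> enat k"
      unfolding irregularity_strength_def by (intro Inf_lower) blast
    then have "ereal_of_enat (irregularity_strength V E) \<le> ereal_of_enat (enat k)"
      by (simp only: ereal_of_enat_le_iff)
    also have "\<dots> < ereal (real (card V) / real d * (1 + 14 / real d powr \<beta>) + 28)"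
      using k(3) by simp
    finally show ?thesis .
  qed
  then show ?thesis by blast
qed

end
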